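(* Let $G$ be a finite $p$-group, where $p$ is a prime number. Let $\chi, \psi \in \operatorname{Irr}(G)$ be faithful characters. Then either $\eta(\chi,\psi)=1$ or $2\eta(\chi,\psi)>p$.
   Context: $\operatorname{Irr}(G)$ denotes the set of irreducible complex characters of the finite group $G$. For $\chi,\psi\in\operatorname{Irr}(G)$, the pointwise product $\chi\psi$ is a character of $G$, and $\eta(\chi,\psi)$ denotes the number of distinct irreducible constituents of $\chi\psi$, i.e. the number of distinct $\theta\in\operatorname{Irr}(G)$ occurring with nonzero multiplicity in $\chi\psi$. A character is faithful if its kernel is trivial. *)

theory Defs
  imports "Jordan_Normal_Form.VS_Connect" "HOL-Library.Multiset"
    "HOL-Computational_Algebra.Primes"
begin

abbreviation general_linear :: "nat \<Rightarrow> complex mat monoid" where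
  "general_linear n \<equiv> units_of (ring_mat TYPE(complex) n ())"

definition representation ::
  "('a, 'b) monoid_scheme \<Rightarrow> nat \<Rightarrow> ('a \<Rightarrow> complex mat) \<Rightarrow> bool" where
  "representation G n \<rho> \<longleftrightarrow> \<rho> \<in> hom G (general_linear n)"

definition irreducible_representation ::
  "('a, 'b) monoid_scheme \<Rightarrow> nat \<Rightarrow> ('a \<Rightarrow> complex mat) \<Rightarrow> bool" where
  "irreducible_representation G n \<rho> \<longleftrightarrow>
     representation G n \<rho> \<and> n > 0 \<and>
     (\<forall>W. subspace class_ring W (module_vec TYPE(complex) n) \<and>
          (\<forall>g\<in>carrier G. \<forall>w\<in>W. \<rho> g *\<^sub>v w \<in> W)
        \<longrightarrow> W = {0\<^sub>v n} \<or> W = carrier_vec n)"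

definition mat_trace :: "complex mat \<Rightarrow> complex" where
  "mat_trace A = (\<Sum>i<dim_row A. A $$ (i, i))"

text \<open>Characters are made extensional (\<^const>\<open>undefined\<close> off the carrier), so that two
  characters are equal as HOL functions iff they agree on the group.\<close>

definition rep_character ::
  "('a, 'b) monoid_scheme \<Rightarrow> ('a \<Rightarrow> complex mat) \<Rightarrow> 'a \<Rightarrow> complex" where
  "rep_character G \<rho> = (\<lambda>g\<in>carrier G. mat_trace (\<rho> g))"

definition Irr :: "('a, 'b) monoid_scheme \<Rightarrow> ('a \<Rightarrow> complex) set" where
  "Irr G = {rep_character G \<rho> | n \<rho>. irreducible_representation G n \<rho>}"

definition char_kernel :: "('a, 'b) monoid_scheme \<Rightarrow> ('a \<Rightarrow> complex) \<Rightarrow> 'a set" where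
  "char_kernel G \<chi> = {g \<in> carrier G. \<chi> g = \<chi> \<one>\<^bsub>G\<^esub>}"

definition faithful_char :: "('a, 'b) monoid_scheme \<Rightarrow> ('a \<Rightarrow> complex) \<Rightarrow> bool" where
  "faithful_char G \<chi> \<longleftrightarrow> char_kernel G \<chi> = {\<one>\<^bsub>G\<^esub>}"

text \<open>A multiset \<open>M\<close> of irreducible characters decomposes \<open>\<phi>\<close> if its elements, counted with
  multiplicity, sum to \<open>\<phi>\<close>. For a character \<open>\<phi>\<close> of a finite group there is exactly one such
  \<open>M\<close> (complete reducibility and linear independence of \<^term>\<open>Irr G\<close>), so the definite
  description below is proper.\<close>

definition irr_decomposition ::
  "('a, 'b) monoid_scheme \<Rightarrow> ('a \<Rightarrow> complex) \<Rightarrow> ('a \<Rightarrow> complex) multiset \<Rightarrow> bool" where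
  "irr_decomposition G \<phi> M \<longleftrightarrow>
     set_mset M \<subseteq> Irr G \<and> (\<forall>g\<in>carrier G. \<phi> g = (\<Sum>\<theta>\<in>#M. \<theta> g))"

definition char_multiplicity ::
  "('a, 'b) monoid_scheme \<Rightarrow> ('a \<Rightarrow> complex) \<Rightarrow> ('a \<Rightarrow> complex) \<Rightarrow> nat" where
  "char_multiplicity G \<phi> \<theta> = count (THE M. irr_decomposition G \<phi> M) \<theta>"

definition irr_constituents ::
  "('a, 'b) monoid_scheme \<Rightarrow> ('a \<Rightarrow> complex) \<Rightarrow> ('a \<Rightarrow> complex) set" where
  "irr_constituents G \<phi> = {\<theta> \<in> Irr G. char_multiplicity G \<phi> \<theta> \<noteq> 0}"

definition eta ::
  "('a, 'b) monoid_scheme \<Rightarrow> ('a \<Rightarrow> complex) \<Rightarrow> ('a \<Rightarrow> complex) \<Rightarrow> nat" where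
  "eta G \<chi> \<psi> = card (irr_constituents G (\<lambda>g. \<chi> g * \<psi> g))"

end

theory Submission
  imports Defs "Jordan_Normal_Form.DL_Rank" "Jordan_Normal_Form.Spectral_Radius"
    "HOL-Algebra.Group_Action" "HOL-Algebra.Multiplicative_Group"
    "HOL-Analysis.Convex" "HOL-Number_Theory.Cong"
begin

text \<open>
  Write \<open>Z\<close> for the centre of \<open>G\<close>. All constituents \<open>\<theta>\<close> of \<open>\<chi>\<psi>\<close> have the same central character
  \<open>\<kappa>\<close>. If \<open>X\<close> is a normal subgroup on which \<open>\<theta>(x) \<theta>(x\<inverse>) = w(x) \<theta>(1)\<^sup>2\<close> for every constituent and
  \<open>\<chi>\<psi>(x) \<chi>\<psi>(x\<inverse>) = v(x) \<chi>\<psi>(1)\<^sup>2\<close>, then Clifford's theorem and the Cauchy-Schwarz inequality bound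
  the number of constituents below by the quotient of the sums of \<open>w\<close> and \<open>v\<close> over \<open>X\<close>.

  If \<open>\<kappa>\<close> is not faithful and \<open>G\<close> is not abelian, let \<open>X / ker \<kappa>\<close> be the centre of \<open>G / ker \<kappa>\<close>. Then
  \<open>w = 1\<close>, and \<open>v\<close> is the indicator function of \<open>Z\<close>, so there are at least \<open>\<bar>X : Z\<bar> \<ge> p\<close> constituents.

  If \<open>\<kappa>\<close> is faithful, call \<open>x\<close> good if every commutator \<open>[g, x]\<close> that lies in \<open>Z\<close> is trivial. If all good
  elements are central, then every constituent vanishes off \<open>Z\<close>, and there is only one. Otherwise let
  \<open>N\<close> be a normal subgroup containing \<open>Z\<close> that is maximal with the property that its good elements are
  central, and let \<open>X / N\<close> be the centre of \<open>G / N\<close>. Schur's lemma, applied to the class sum of \<open>x \<in> X\<close>,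
  shows that \<open>w(x)\<close> is the inverse of the size of the class of \<open>x\<close> if \<open>x\<close> is good and \<open>0\<close> otherwise, and
  \<open>v = w\<^sup>2\<close>. Each coset of \<open>N\<close> in \<open>X\<close> that contains a good element contributes \<open>\<bar>Z\<bar>\<close> to the sum of \<open>w\<close>,
  and there are at least \<open>p\<close> such cosets, since powers of good elements are good. As \<open>w \<le> 1 / p\<close> off \<open>Z\<close>,
  the quotient of the two sums is greater than \<open>p / 2\<close>.
\<close>

section \<open>Schur's lemma\<close>

text \<open>Invertibility is automatic: \<open>\<rho> (inv g)\<close> is a two-sided inverse of
  \<open>\<rho> g\<close>. Homomorphisms into the unit group thus reduce to plain matrix
  equations.\<close>

lemma representation_iff:
  assumes "group G"
  shows "representation G n \<rho> \<longleftrightarrow>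
    (\<forall>g\<in>carrier G. \<rho> g \<in> carrier_mat n n) \<and>
    (\<forall>g\<in>carrier G. \<forall>h\<in>carrier G. \<rho> (g \<otimes>\<^bsub>G\<^esub> h) = \<rho> g * \<rho> h) \<and> \<rho> \<one>\<^bsub>G\<^esub> = 1\<^sub>m n"
    (is "_ \<longleftrightarrow> ?R")
proof
  interpret G: group G by fact
  interpret M: monoid "ring_mat TYPE(complex) n ()"
    using ring_mat[where 'a = complex and n = n and b = "()"] by (simp add: ring_def)
  assume r: "representation G n \<rho>"
  then have h: "\<rho> \<in> hom G (general_linear n)" by (simp add: representation_def)
  have one: "\<rho> \<one>\<^bsub>G\<^esub> = \<one>\<^bsub>general_linear n\<^esub>"
    using h by (rule hom_one) (use G.is_group M.units_group in auto)
  show ?R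
    using h one
    by (auto simp: hom_def units_of_def Units_def ring_mat_simps Pi_iff)
next
  interpret G: group G by fact
  assume r: ?R
  show "representation G n \<rho>"
    unfolding representation_def
  proof (rule homI)
    fix g assume g: "g \<in> carrier G"
    have "\<rho> (inv\<^bsub>G\<^esub> g) * \<rho> g = 1\<^sub>m n" "\<rho> g * \<rho> (inv\<^bsub>G\<^esub> g) = 1\<^sub>m n"
      using r g by (metis G.inv_closed G.l_inv, metis G.inv_closed G.r_inv)
    then show "\<rho> g \<in> carrier (general_linear n)"
      using r g by (auto simp: units_of_def Units_def ring_mat_simps intro!: bexI[of _ "\<rho> (inv\<^bsub>G\<^esub> g)"])
  qed (use r in \<open>auto simp: units_of_def ring_mat_simps\<close>)
qed

lemma subspace_vec_iff:
  "VectorSpace.subspace class_ring W (module_vec TYPE(complex) n) \<longleftrightarrow>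
    W \<subseteq> carrier_vec n \<and> 0\<^sub>v n \<in> W \<and> (\<forall>v\<in>W. \<forall>w\<in>W. v + w \<in> W) \<and> (\<forall>c. \<forall>v\<in>W. c \<cdot>\<^sub>v v \<in> W)"
  using vec_vs[of n, where 'a = complex] vec_module[of n, where 'a = complex]
  by (auto simp: VectorSpace.subspace_def submodule_def module_vec_simps)

text \<open>Over the complex numbers \<open>A\<close> has an eigenvalue. Its eigenspace is nonzero,
  and invariant because \<open>A\<close> commutes with the representation, so irreducibility makes
  it the whole space.\<close>

lemma schur_scalar:
  assumes G: "group G" and irr: "irreducible_representation G n \<rho>"
    and A: "A \<in> carrier_mat n n"
    and comm: "\<And>g. g \<in> carrier G \<Longrightarrow> A * \<rho> g = \<rho> g * A"
  obtains c where "A = c \<cdot>\<^sub>m 1\<^sub>m n"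
proof -
  have n: "n > 0" and rep: "representation G n \<rho>" using irr by (auto simp: irreducible_representation_def)
  have \<rho>: "\<And>g. g \<in> carrier G \<Longrightarrow> \<rho> g \<in> carrier_mat n n"
    using rep by (simp add: representation_iff[OF G])
  obtain c where "eigenvalue A c"
    using spectrum_non_empty[OF A n] by (auto simp: spectrum_def)
  then obtain v where v: "v \<in> carrier_vec n" "v \<noteq> 0\<^sub>v n" "A *\<^sub>v v = c \<cdot>\<^sub>v v"
    using A by (auto simp: eigenvalue_def eigenvector_def)
  define W where "W = {w \<in> carrier_vec n. A *\<^sub>v w = c \<cdot>\<^sub>v w}"
  have "VectorSpace.subspace class_ring W (module_vec TYPE(complex) n)"
    unfolding subspace_vec_iff using A
    by (auto simp: W_def mult_add_distrib_mat_vec[OF A] mult_mat_vec[OF A]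
          smult_add_distrib_vec[of _ n] smult_smult_assoc mult.commute intro!: eq_vecI)
  moreover have "\<rho> g *\<^sub>v w \<in> W" if "g \<in> carrier G" "w \<in> W" for g w
  proof -
    have w: "w \<in> carrier_vec n" "A *\<^sub>v w = c \<cdot>\<^sub>v w" using that by (auto simp: W_def)
    have "A *\<^sub>v (\<rho> g *\<^sub>v w) = (A * \<rho> g) *\<^sub>v w"
      using A \<rho>[OF that(1)] w by simp
    also have "\<dots> = (\<rho> g * A) *\<^sub>v w" by (simp only: comm[OF that(1)])
    also have "\<dots> = c \<cdot>\<^sub>v (\<rho> g *\<^sub>v w)"
      using A \<rho>[OF that(1)] w by (simp add: mult_mat_vec)
    finally show ?thesis using \<rho>[OF that(1)] w by (auto simp: W_def)
  qed
  ultimately have "W = {0\<^sub>v n} \<or> W = carrier_vec n"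
    using irr unfolding irreducible_representation_def by blast
  moreover have "v \<in> W" using v by (auto simp: W_def)
  ultimately have W: "W = carrier_vec n" using v by auto
  have "A = c \<cdot>\<^sub>m 1\<^sub>m n"
  proof (rule eq_matI)
    fix i j assume ij: "i < dim_row (c \<cdot>\<^sub>m 1\<^sub>m n)" "j < dim_col (c \<cdot>\<^sub>m 1\<^sub>m n)"
    then have "unit_vec n j \<in> W" using W by simp
    then have "A *\<^sub>v unit_vec n j = c \<cdot>\<^sub>v unit_vec n j" by (simp add: W_def)
    then have "(A *\<^sub>v unit_vec n j) $ i = (c \<cdot>\<^sub>v unit_vec n j) $ i" by simp
    then show "A $$ (i, j) = (c \<cdot>\<^sub>m 1\<^sub>m n) $$ (i, j)"
      using ij A by (auto simp: scalar_prod_right_unit)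
  qed (use A in auto)
  then show ?thesis by (rule that)
qed


section \<open>Matrix traces and sums over conjugation-invariant sets\<close>

lemma index_mult_mat_sum:
  assumes "A \<in> carrier_mat n m" "B \<in> carrier_mat m l" "i < n" "j < l"
  shows "(A * B) $$ (i, j) = (\<Sum>k<m. A $$ (i, k) * B $$ (k, j))"
  using assms by (simp add: scalar_prod_def lessThan_atLeast0)

lemma mat_trace_carrier: "A \<in> carrier_mat n n \<Longrightarrow> mat_trace A = (\<Sum>i<n. A $$ (i, i))"
  by (simp add: mat_trace_def)

lemma mat_trace_comm:
  assumes "A \<in> carrier_mat n m" "B \<in> carrier_mat m n"
  shows "mat_trace (A * B) = mat_trace (B * A)"
proof -
  have "mat_trace (A * B) = (\<Sum>i<n. \<Sum>k<m. A $$ (i, k) * B $$ (k, i))"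
    using assms by (simp add: mat_trace_def index_mult_mat_sum[OF assms] del: index_mult_mat(1))
  also have "\<dots> = (\<Sum>k<m. \<Sum>i<n. B $$ (k, i) * A $$ (i, k))"
    by (subst sum.swap) (simp add: mult.commute)
  also have "\<dots> = mat_trace (B * A)"
    using assms by (simp add: mat_trace_def index_mult_mat_sum[OF assms(2,1)] del: index_mult_mat(1))
  finally show ?thesis .
qed

lemma (in group) sum_conjugate:
  assumes "g \<in> carrier G" and X: "X \<subseteq> carrier G"
    and inv: "\<And>g u. g \<in> carrier G \<Longrightarrow> u \<in> X \<Longrightarrow> g \<otimes> u \<otimes> inv g \<in> X"
  shows "(\<Sum>u\<in>X. f (g \<otimes> u \<otimes> inv g)) = (\<Sum>u\<in>X. f u)"
proof (rule sum.reindex_bij_witness[where i = "\<lambda>u. inv g \<otimes> u \<otimes> g" and j = "\<lambda>u. g \<otimes> u \<otimes> inv g"])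
  fix u assume u: "u \<in> X"
  show "inv g \<otimes> u \<otimes> g \<in> X" using inv[of "inv g" u] assms(1) u by simp
  have uc: "u \<in> carrier G" using u X by auto
  show "g \<otimes> (inv g \<otimes> u \<otimes> g) \<otimes> inv g = u" "inv g \<otimes> (g \<otimes> u \<otimes> inv g) \<otimes> g = u"
    using assms(1) uc by (simp_all add: m_assoc) (simp_all flip: m_assoc)
qed (use inv assms in auto)

section \<open>Trace identities for a fixed irreducible representation\<close>

context
  fixes G (structure) and n \<rho>
  assumes G: "group G" and irr: "irreducible_representation G n \<rho>"
begin

interpretation group G by (rule G)

lemma
  shows irr_rep_dim: "n > 0"
    and irr_rep_carrier: "g \<in> carrier G \<Longrightarrow> \<rho> g \<in> carrier_mat n n"
    and irr_rep_mult: "g \<in> carrier G \<Longrightarrow> h \<in> carrier G \<Longrightarrow> \<rho> (g \<otimes> h) = \<rho> g * \<rho> h"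
    and irr_rep_one: "\<rho> \<one> = 1\<^sub>m n"
  using irr by (auto simp: irreducible_representation_def representation_iff[OF G])

text \<open>Schur's lemma makes \<open>A\<close> a scalar matrix with some scalar \<open>c\<close>,
  and both sides become the square of \<open>n\<close> times \<open>c * mat_trace B\<close> divided
  by \<open>n\<close>.\<close>

lemma irr_rep_commuting_trace:
  assumes A: "A \<in> carrier_mat n n"
    and comm: "\<And>g. g \<in> carrier G \<Longrightarrow> A * \<rho> g = \<rho> g * A"
    and B: "B \<in> carrier_mat n n"
  shows "of_nat n * mat_trace (A * B) = mat_trace A * mat_trace B"
proof -
  obtain c where "A = c \<cdot>\<^sub>m 1\<^sub>m n" using schur_scalar[OF G irr A comm] .
  then show ?thesis using B by (simp add: mat_trace_def sum_distrib_left mult.assoc)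
qed

text \<open>The sum of the matrices \<open>F u\<close> times \<open>\<rho> u\<close> commutes with
  the representation, since conjugation permutes \<open>X\<close> and preserves \<open>F\<close>.
  The trace identity for commuting matrices then applies with \<open>B = \<rho> y\<close>.\<close>

lemma irr_rep_class_sum:
  assumes X: "X \<subseteq> carrier G" and y: "y \<in> carrier G"
    and inv: "\<And>g u. g \<in> carrier G \<Longrightarrow> u \<in> X \<Longrightarrow> g \<otimes> u \<otimes> inv g \<in> X"
    and F: "\<And>g u. g \<in> carrier G \<Longrightarrow> u \<in> X \<Longrightarrow> F (g \<otimes> u \<otimes> inv g) = F u"
  shows "of_nat n * (\<Sum>u\<in>X. F u * mat_trace (\<rho> (u \<otimes> y))) =
    (\<Sum>u\<in>X. F u * mat_trace (\<rho> u)) * mat_trace (\<rho> y)"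
proof -
  note [simp] = irr_rep_carrier
  define A where "A = mat n n (\<lambda>ij. \<Sum>u\<in>X. F u * \<rho> u $$ ij)"
  have A[simp]: "A \<in> carrier_mat n n" by (simp add: A_def)
  have AB: "(A * \<rho> g) $$ (i, j) = (\<Sum>u\<in>X. F u * \<rho> (u \<otimes> g) $$ (i, j))"
    if "g \<in> carrier G" "i < n" "j < n" for g i j
  proof -
    have "(A * \<rho> g) $$ (i, j) = (\<Sum>k<n. \<Sum>u\<in>X. F u * (\<rho> u $$ (i, k) * \<rho> g $$ (k, j)))"
      using that by (simp add: index_mult_mat_sum[of _ n n _ n] A_def sum_distrib_right mult.assoc)
    also have "\<dots> = (\<Sum>u\<in>X. F u * (\<rho> u * \<rho> g) $$ (i, j))"
      using that X by (subst sum.swap)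
        (auto intro!: sum.cong simp: index_mult_mat_sum[of _ n n _ n] sum_distrib_left)
    also have "\<dots> = (\<Sum>u\<in>X. F u * \<rho> (u \<otimes> g) $$ (i, j))"
      using that X by (auto intro!: sum.cong simp: irr_rep_mult)
    finally show ?thesis .
  qed
  have BA: "(\<rho> g * A) $$ (i, j) = (\<Sum>u\<in>X. F u * \<rho> (g \<otimes> u) $$ (i, j))"
    if "g \<in> carrier G" "i < n" "j < n" for g i j
  proof -
    have "(\<rho> g * A) $$ (i, j) = (\<Sum>k<n. \<Sum>u\<in>X. F u * (\<rho> g $$ (i, k) * \<rho> u $$ (k, j)))"
      using that by (simp add: index_mult_mat_sum[of _ n n _ n] A_def sum_distrib_left ac_simps)
    also have "\<dots> = (\<Sum>u\<in>X. F u * (\<rho> g * \<rho> u) $$ (i, j))"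
      using that X by (subst sum.swap)
        (auto intro!: sum.cong simp: index_mult_mat_sum[of _ n n _ n] sum_distrib_left)
    also have "\<dots> = (\<Sum>u\<in>X. F u * \<rho> (g \<otimes> u) $$ (i, j))"
      using that X by (auto intro!: sum.cong simp: irr_rep_mult)
    finally show ?thesis .
  qed
  have comm: "A * \<rho> g = \<rho> g * A" if g: "g \<in> carrier G" for g
  proof (rule eq_matI)
    fix i j assume "i < dim_row (\<rho> g * A)" "j < dim_col (\<rho> g * A)"
    then have ij: "i < n" "j < n" using g A irr_rep_carrier[OF g] by auto
    have "(\<rho> g * A) $$ (i, j) = (\<Sum>u\<in>X. F u * \<rho> (g \<otimes> u) $$ (i, j))" using BA g ij by simp
    also have "\<dots> = (\<Sum>u\<in>X. F (g \<otimes> u \<otimes> inv g) * \<rho> (g \<otimes> u \<otimes> inv g \<otimes> g) $$ (i, j))"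
    proof (rule sum.cong)
      fix u assume u: "u \<in> X"
      then have "g \<otimes> u \<otimes> inv g \<otimes> g = g \<otimes> u" using X g by (auto simp: m_assoc)
      then show "F u * \<rho> (g \<otimes> u) $$ (i, j)
          = F (g \<otimes> u \<otimes> inv g) * \<rho> (g \<otimes> u \<otimes> inv g \<otimes> g) $$ (i, j)"
        using F[OF g u] by simp
    qed simp
    also have "\<dots> = (\<Sum>u\<in>X. F u * \<rho> (u \<otimes> g) $$ (i, j))"
      by (rule sum_conjugate[OF g X inv])
    also have "\<dots> = (A * \<rho> g) $$ (i, j)" using AB g ij by simp
    finally show "(A * \<rho> g) $$ (i, j) = (\<rho> g * A) $$ (i, j)" by simp
  qed (use carrier_matD[OF A] carrier_matD[OF irr_rep_carrier[OF g]] in auto)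
  have "mat_trace (A * \<rho> y) = (\<Sum>i<n. \<Sum>u\<in>X. F u * \<rho> (u \<otimes> y) $$ (i, i))"
    by (simp add: mat_trace_carrier[OF mult_carrier_mat[OF A irr_rep_carrier[OF y]]] AB y
          del: index_mult_mat(1))
  also have "\<dots> = (\<Sum>u\<in>X. F u * mat_trace (\<rho> (u \<otimes> y)))"
    using X y by (subst sum.swap) (auto intro!: sum.cong
        simp: mat_trace_carrier[OF irr_rep_carrier] sum_distrib_left subset_iff)
  finally have 1: "mat_trace (A * \<rho> y) = (\<Sum>u\<in>X. F u * mat_trace (\<rho> (u \<otimes> y)))" .
  have "mat_trace A = (\<Sum>i<n. \<Sum>u\<in>X. F u * \<rho> u $$ (i, i))"
    by (simp add: mat_trace_def A_def)
  also have "\<dots> = (\<Sum>u\<in>X. F u * mat_trace (\<rho> u))"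
    using X by (subst sum.swap) (auto intro!: sum.cong
        simp: mat_trace_carrier[OF irr_rep_carrier] sum_distrib_left subset_iff)
  finally show ?thesis
    using irr_rep_commuting_trace[OF A comm irr_rep_carrier[OF y]] 1 by simp
qed

text \<open>\<open>A k l\<close> sums all conjugates of the matrix unit at position
  \<open>(k, l)\<close>. Schur's lemma makes it scalar, and its trace determines the scalar. The
  required sum collects the entries \<open>A i j $$ (i, j)\<close>.\<close>

lemma irr_rep_norm:
  assumes fin: "finite (carrier G)"
  shows "(\<Sum>g\<in>carrier G. mat_trace (\<rho> g) * mat_trace (\<rho> (inv g))) = of_nat (card (carrier G))"
proof -
  note [simp] = irr_rep_carrier
  define A where "A = (\<lambda>k l. mat n n (\<lambda>(i, j). \<Sum>g\<in>carrier G. \<rho> g $$ (i, k) * \<rho> (inv g) $$ (l, j)))"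
  have A[simp]: "A k l \<in> carrier_mat n n" for k l by (simp add: A_def)
  have one: "(\<Sum>m<n. \<rho> (inv g) $$ (l, m) * \<rho> g $$ (m, k)) = (if k = l then 1 else 0)"
    if "g \<in> carrier G" "k < n" "l < n" for g k l
  proof -
    have "\<rho> (inv g) * \<rho> g = 1\<^sub>m n"
      using irr_rep_mult[of "inv g" g] that(1) irr_rep_one by simp
    then show ?thesis
      using that by (simp add: index_mult_mat_sum[of _ n n _ n, symmetric] del: index_mult_mat(1))
  qed
  have entry: "A k l $$ (i, j) * of_nat n = (if i = j \<and> k = l then of_nat (card (carrier G)) else 0)"
    if ij: "i < n" "j < n" "k < n" "l < n" for i j k l
  proof -
    have comm: "A k l * \<rho> h = \<rho> h * A k l" if h: "h \<in> carrier G" for h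
    proof (rule eq_matI)
      fix i j assume "i < dim_row (\<rho> h * A k l)" "j < dim_col (\<rho> h * A k l)"
      then have ij': "i < n" "j < n" using h A[of k l] irr_rep_carrier[OF h] by auto
      have "(A k l * \<rho> h) $$ (i, j)
          = (\<Sum>m<n. \<Sum>g\<in>carrier G. \<rho> g $$ (i, k) * (\<rho> (inv g) $$ (l, m) * \<rho> h $$ (m, j)))"
        using ij' h by (simp add: index_mult_mat_sum[of _ n n _ n] A_def sum_distrib_right mult.assoc)
      also have "\<dots> = (\<Sum>g\<in>carrier G. \<rho> g $$ (i, k) * (\<rho> (inv g) * \<rho> h) $$ (l, j))"
        using ij ij' h by (subst sum.swap)
          (auto intro!: sum.cong simp: index_mult_mat_sum[of _ n n _ n] sum_distrib_left)
      \<comment> \<open>Replacing \<open>g\<close> by \<open>h \<otimes> g\<close> moves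
        \<open>h\<close> from the right factor to the left one.\<close>
      also have "\<dots> = (\<Sum>g\<in>carrier G. \<rho> (h \<otimes> g) $$ (i, k) * \<rho> (inv g) $$ (l, j))"
      proof (rule sum.reindex_bij_witness[where i = "\<lambda>g. h \<otimes> g" and j = "\<lambda>g. inv h \<otimes> g"])
        fix g assume g: "g \<in> carrier G"
        show "h \<otimes> (inv h \<otimes> g) = g" "inv h \<otimes> (h \<otimes> g) = g"
          using g h by (simp_all flip: m_assoc)
        show "\<rho> (h \<otimes> (inv h \<otimes> g)) $$ (i, k) * \<rho> (inv (inv h \<otimes> g)) $$ (l, j)
            = \<rho> g $$ (i, k) * (\<rho> (inv g) * \<rho> h) $$ (l, j)"
          using g h by (simp add: inv_mult_group irr_rep_mult flip: m_assoc)
      qed (use h in auto)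
      also have "\<dots> = (\<Sum>g\<in>carrier G. \<Sum>m<n. \<rho> h $$ (i, m) * (\<rho> g $$ (m, k) * \<rho> (inv g) $$ (l, j)))"
        using ij ij' h by (auto intro!: sum.cong
            simp: index_mult_mat_sum[of _ n n _ n] sum_distrib_right irr_rep_mult mult.assoc)
      also have "\<dots> = (\<rho> h * A k l) $$ (i, j)"
        using ij' h by (subst sum.swap)
          (simp add: index_mult_mat_sum[of _ n n _ n] A_def sum_distrib_left)
      finally show "(A k l * \<rho> h) $$ (i, j) = (\<rho> h * A k l) $$ (i, j)" .
    qed (use carrier_matD[OF A[of k l]] carrier_matD[OF irr_rep_carrier[OF h]] in auto)
    obtain c where c: "A k l = c \<cdot>\<^sub>m 1\<^sub>m n" using schur_scalar[OF G irr A comm] .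
    have "mat_trace (A k l) = (\<Sum>i<n. \<Sum>g\<in>carrier G. \<rho> g $$ (i, k) * \<rho> (inv g) $$ (l, i))"
      by (simp add: mat_trace_def A_def)
    also have "\<dots> = (\<Sum>g\<in>carrier G. \<Sum>i<n. \<rho> (inv g) $$ (l, i) * \<rho> g $$ (i, k))"
      by (subst sum.swap) (simp add: mult.commute)
    also have "\<dots> = (if k = l then of_nat (card (carrier G)) else 0)"
      using ij by (simp add: one)
    finally show ?thesis using c ij by (auto simp: mat_trace_def mult.commute)
  qed
  have "(\<Sum>g\<in>carrier G. mat_trace (\<rho> g) * mat_trace (\<rho> (inv g)))
      = (\<Sum>g\<in>carrier G. \<Sum>i<n. \<Sum>j<n. \<rho> g $$ (i, i) * \<rho> (inv g) $$ (j, j))"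
    by (auto intro!: sum.cong simp: mat_trace_carrier[OF irr_rep_carrier] sum_product)
  also have "\<dots> = (\<Sum>i<n. \<Sum>g\<in>carrier G. \<Sum>j<n. \<rho> g $$ (i, i) * \<rho> (inv g) $$ (j, j))"
    by (rule sum.swap)
  also have "\<dots> = (\<Sum>i<n. \<Sum>j<n. A i j $$ (i, j))"
    by (rule sum.cong[OF refl], subst sum.swap) (simp add: A_def)
  also have "\<dots> = (\<Sum>i<n. \<Sum>j<n. if i = j then of_nat (card (carrier G)) / of_nat n else 0)"
  proof (intro sum.cong refl)
    fix i j assume "i \<in> {..<n}" "j \<in> {..<n}"
    then show "A i j $$ (i, j) = (if i = j then of_nat (card (carrier G)) / of_nat n else 0)"
      using entry[of i j i j] irr_rep_dim by (auto simp: field_simps split: if_splits)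
  qed
  also have "\<dots> = of_nat (card (carrier G))" using irr_rep_dim by simp
  finally show ?thesis .
qed

end

section \<open>Decomposition of representations\<close>

text \<open>A maximal independent subset \<open>A\<close> of \<open>W\<close> spans
  \<open>W\<close>, and a maximal independent set \<open>B\<close> containing \<open>A\<close> is a
  basis of the whole space. Both exist because independent sets have at most \<open>n\<close>
  elements.\<close>

lemma (in vec_space) subspace_basis_exists:
  assumes W: "VectorSpace.subspace class_ring W V"
  obtains A B where "A \<subseteq> B" "finite B" "basis B" "W = span A" "A \<subseteq> W"
proof -
  have WV: "W \<subseteq> carrier_vec n" and sub: "submodule class_ring W V"
    using W by (auto simp: VectorSpace.subspace_def submodule_def)
  have bound: "finite S \<and> card S \<le> n" if "S \<subseteq> carrier_vec n" "lin_indpt S" for S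
    using li_le_dim[of S] that dim_is_n by auto
  have "lin_indpt {}" by (rule finite_lin_indpt2) auto
  then have "\<exists>A. finite A \<and> maximal A (\<lambda>S. S \<subseteq> W \<and> lin_indpt S)"
    using bound WV by (intro maximal_exists[where N = n and B = "{}"]) blast+
  then obtain A where A: "finite A" "maximal A (\<lambda>S. S \<subseteq> W \<and> lin_indpt S)" by blast
  then have AW: "A \<subseteq> W" "lin_indpt A" by (auto simp: maximal_def)
  have "W \<subseteq> span A"
  proof
    fix w assume w: "w \<in> W"
    show "w \<in> span A"
    proof (rule ccontr)
      assume "w \<notin> span A"
      then have "lin_indpt (A \<union> {w})" "w \<notin> A"
        using lin_dep_iff_in_span[of A w] AW w WV in_own_span[of A] by auto
      then show False using A(2) AW w unfolding maximal_def by blast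
    qed
  qed
  moreover have "span A \<subseteq> W" using span_is_subset[OF AW(1)] sub by simp
  ultimately have WA: "W = span A" by auto
  have "\<exists>B. finite B \<and> maximal B (\<lambda>S. A \<subseteq> S \<and> S \<subseteq> carrier_vec n \<and> lin_indpt S)"
    using bound WV AW by (intro maximal_exists[where N = n and B = A]) blast+
  then obtain B where B: "finite B" "maximal B (\<lambda>S. A \<subseteq> S \<and> S \<subseteq> carrier_vec n \<and> lin_indpt S)"
    by blast
  have AB: "A \<subseteq> B" "B \<subseteq> carrier_vec n" "lin_indpt B"
    using B(2) unfolding maximal_def by blast+
  have max: "C = B" if "B \<subseteq> C" "A \<subseteq> C" "C \<subseteq> carrier_vec n" "lin_indpt C" for C
    using that B(2) unfolding maximal_def by blast
  have "maximal B (\<lambda>S. S \<subseteq> carrier_vec n \<and> lin_indpt S)"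
    unfolding maximal_def
  proof (intro conjI allI impI)
    fix C assume C: "B \<subseteq> C \<and> C \<subseteq> carrier_vec n \<and> lin_indpt C"
    then have "A \<subseteq> C" using AB(1) by blast
    then show "C = B" using max C by metis
  qed (rule AB(2), rule AB(3))
  then have "basis B" by (intro max_li_is_basis) simp
  then show ?thesis by (rule that[OF AB(1) B(1) _ WA AW(1)])
qed

text \<open>The columns of \<open>P\<close> are a basis of \<open>W\<close> followed by its
  completion to a basis of the whole space, so \<open>Q *\<^sub>v w\<close> is the coordinate vector
  of \<open>w\<close>.\<close>

lemma subspace_adapted_matrix:
  fixes W :: "complex vec set"
  assumes W: "VectorSpace.subspace class_ring W (module_vec TYPE(complex) n)"
  obtains k P Q where "k \<le> n" "P \<in> carrier_mat n n" "Q \<in> carrier_mat n n"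
    "P * Q = 1\<^sub>m n" "Q * P = 1\<^sub>m n"
    "\<And>j. j < k \<Longrightarrow> col P j \<in> W"
    "\<And>w i. w \<in> W \<Longrightarrow> k \<le> i \<Longrightarrow> i < n \<Longrightarrow> (Q *\<^sub>v w) $ i = 0"
    "k = n \<Longrightarrow> W = carrier_vec n"
proof -
  interpret vec_space "TYPE(complex)" n .
  obtain A B where AB: "A \<subseteq> B" "finite B" "basis B" "W = span A" "A \<subseteq> W"
    using subspace_basis_exists[OF W] by blast
  have B: "lin_indpt B" "B \<subseteq> carrier_vec n" using AB(3) by (auto simp: basis_def)
  have finA: "finite A" using AB finite_subset by blast
  obtain xs where xs: "set xs = A" "distinct xs" using finite_distinct_list[OF finA] by blast
  obtain ys where ys: "set ys = B - A" "distinct ys"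
    using finite_distinct_list[of "B - A"] AB(2) by blast
  define zs where "zs = xs @ ys"
  have zs: "set zs = B" "distinct zs" using xs ys AB(1) by (auto simp: zs_def)
  have "card B = n" using dim_basis[OF AB(2,3)] dim_is_n by simp
  then have len: "length zs = n" using zs distinct_card by fastforce
  define P where "P = mat_of_cols n zs"
  have P[simp]: "P \<in> carrier_mat n n" unfolding P_def using mat_of_cols_carrier(1)[of n zs] len by (simp only:)
  have cols: "cols P = zs" unfolding P_def using zs B by (intro cols_mat_of_cols) auto
  have "rank P = n" using lin_indpt_full_rank[OF P] zs B cols by simp
  then have "det P \<noteq> 0" using det_rank_iff[OF P] by simp
  then obtain Q where Q: "Q \<in> carrier_mat n n" "Q * P = 1\<^sub>m n" "P * Q = 1\<^sub>m n"
    using det_non_zero_imp_unit[OF P, of "()"]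
    by (auto simp: Units_def ring_mat_simps)
  have kn: "length xs \<le> n" using len by (simp add: zs_def)
  have col: "col P j = zs ! j" if "j < n" for j
    using that len cols P by (metis cols_nth carrier_matD(2))
  show ?thesis
  proof (rule that[OF kn P Q(1,3,2)])
    fix j assume "j < length xs"
    then show "col P j \<in> W" using col[of j] kn xs AB(5) by (auto simp: zs_def nth_append)
  next
    fix w i assume w: "w \<in> W" and i: "length xs \<le> i" "i < n"
    then obtain a where a: "w = lincomb a A" using finite_in_span[OF finA, of w] AB B by blast
    \<comment> \<open>Extending the coefficients by zero writes \<open>w\<close> over all of
      \<open>B\<close>, that is, over the columns of \<open>P\<close>.\<close>
    define b where "b = (\<lambda>v. if v \<in> A then a v else 0)"
    have "lincomb b B = w"
    proof (rule eq_vecI)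
      fix i assume "i < dim_vec w"
      then have i: "i < n" using a AB B by (simp add: lincomb_dim finA)
      have "lincomb b B $ i = (\<Sum>x\<in>B. b x * x $ i)" using lincomb_index[OF i B(2)] .
      also have "\<dots> = (\<Sum>x\<in>A. a x * x $ i)"
        using AB by (intro sum.mono_neutral_cong_right) (auto simp: b_def)
      also have "\<dots> = w $ i" using lincomb_index[OF i, of A a] AB B a by simp
      finally show "lincomb b B $ i = w $ i" .
    qed (use a AB B finA in \<open>simp add: lincomb_dim\<close>)
    then have "w = P *\<^sub>v vec n (\<lambda>i. b (col P i))"
      using mat_mult_eq_lincomb[OF P, of b] cols zs by simp
    then have "Q *\<^sub>v w = (Q * P) *\<^sub>v vec n (\<lambda>i. b (col P i))"
      using assoc_mult_mat_vec[OF Q(1) P, of "vec n (\<lambda>i. b (col P i))"] by simp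
    then have "Q *\<^sub>v w = vec n (\<lambda>i. b (col P i))" using Q by simp
    then have "(Q *\<^sub>v w) $ i = b (zs ! i)" by (simp only: index_vec[OF i(2)] col[OF i(2)])
    also have "zs ! i = ys ! (i - length xs)" using i by (simp add: zs_def nth_append)
    also have "b \<dots> = 0"
    proof -
      have "ys ! (i - length xs) \<in> set ys" using i len by (intro nth_mem) (auto simp: zs_def)
      then show ?thesis using ys by (auto simp: b_def)
    qed
    finally show "(Q *\<^sub>v w) $ i = 0" .
  next
    assume "length xs = n"
    then have "B \<subseteq> A" using len ys by (auto simp: zs_def)
    then show "W = carrier_vec n" using AB by (auto simp: basis_def)
  qed
qed

text \<open>In a basis adapted to \<open>W\<close> the matrices are block upper triangular. The two
  diagonal blocks are representations and carry the whole trace, whatever the upper right block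
  is.\<close>

lemma invariant_subspace_splits_trace:
  assumes G: "group G" and rep: "representation G n \<rho>"
    and W: "VectorSpace.subspace class_ring W (module_vec TYPE(complex) n)"
    and inv: "\<forall>g\<in>carrier G. \<forall>w\<in>W. \<rho> g *\<^sub>v w \<in> W"
    and proper: "W \<noteq> {0\<^sub>v n}" "W \<noteq> carrier_vec n"
  obtains k \<sigma> \<tau> where "k < n" "n - k < n" "representation G k \<sigma>" "representation G (n - k) \<tau>"
    "\<And>g. g \<in> carrier G \<Longrightarrow> mat_trace (\<rho> g) = mat_trace (\<sigma> g) + mat_trace (\<tau> g)"
proof -
  obtain k P Q where kPQ: "k \<le> n" "P \<in> carrier_mat n n" "Q \<in> carrier_mat n n"
    "P * Q = 1\<^sub>m n" "Q * P = 1\<^sub>m n"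
    "\<And>j. j < k \<Longrightarrow> col P j \<in> W"
    "\<And>w i. w \<in> W \<Longrightarrow> k \<le> i \<Longrightarrow> i < n \<Longrightarrow> (Q *\<^sub>v w) $ i = 0"
    "k = n \<Longrightarrow> W = carrier_vec n"
    using subspace_adapted_matrix[OF W] by blast
  note [simp] = kPQ(2,3)
  have mc[simp]: "A * B \<in> carrier_mat n n" if "A \<in> carrier_mat n n" "B \<in> carrier_mat n n"
    for A B :: "complex mat" using that by simp
  have WV: "W \<subseteq> carrier_vec n" "0\<^sub>v n \<in> W" using W by (auto simp: subspace_vec_iff)
  have PQw: "P *\<^sub>v (Q *\<^sub>v w) = w" if "w \<in> carrier_vec n" for w
    using that kPQ by (simp flip: assoc_mult_mat_vec[of _ n n _ n])
  \<comment> \<open>Both blocks must be strictly smaller than \<open>n\<close>, since the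
    decomposition proceeds by induction on the degree.\<close>
  have "k \<noteq> 0"
  proof
    assume "k = 0"
    have "w = 0\<^sub>v n" if "w \<in> W" for w
    proof -
      have "Q *\<^sub>v w = 0\<^sub>v n" using kPQ(7)[OF that] \<open>k = 0\<close> carrier_matD[OF kPQ(3)] by (intro eq_vecI) auto
      moreover have "P *\<^sub>v 0\<^sub>v n = 0\<^sub>v n" using carrier_matD[OF kPQ(2)] by (intro eq_vecI) auto
      ultimately show ?thesis using PQw[of w] that WV(1) by auto
    qed
    then have "W = {0\<^sub>v n}" using WV(2) by blast
    then show False using proper(1) by simp
  qed
  moreover have "k \<noteq> n" using kPQ(8) proper(2) by blast
  ultimately have k: "0 < k" "k < n" using kPQ(1) by auto
  have \<rho>: "g \<in> carrier G \<Longrightarrow> \<rho> g \<in> carrier_mat n n"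
      "g \<in> carrier G \<Longrightarrow> h \<in> carrier G \<Longrightarrow> \<rho> (g \<otimes>\<^bsub>G\<^esub> h) = \<rho> g * \<rho> h"
      "\<rho> \<one>\<^bsub>G\<^esub> = 1\<^sub>m n" for g h
    using rep by (auto simp: representation_iff[OF G])
  define R where "R = (\<lambda>g. Q * \<rho> g * P)"
  have R[simp]: "R g \<in> carrier_mat n n" if "g \<in> carrier G" for g unfolding R_def by (intro mult_carrier_mat[of _ n n] kPQ(2,3) \<rho>(1)[OF that])
  have Rmult: "R (g \<otimes>\<^bsub>G\<^esub> h) = R g * R h" if "g \<in> carrier G" "h \<in> carrier G" for g h
  proof -
    note [simp] = \<rho>(1)[OF that(1)] \<rho>(1)[OF that(2)]
    have "R g * R h = Q * (\<rho> g * ((P * Q) * (\<rho> h * P)))"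
      by (simp add: R_def assoc_mult_mat[of _ n n _ n _ n] )
    also have "\<dots> = Q * (\<rho> g * (\<rho> h * P))"
      by (simp add: kPQ(4) left_mult_one_mat[of _ n n])
    finally show ?thesis using that
      by (simp add: R_def \<rho>(2) assoc_mult_mat[of _ n n _ n _ n])
  qed
  have Rone: "R \<one>\<^bsub>G\<^esub> = 1\<^sub>m n" by (simp add: R_def \<rho>(3) right_mult_one_mat[of _ n n] kPQ(5))
  \<comment> \<open>\<open>P\<close> sends the unit vector with index \<open>j < k\<close> into
    \<open>W\<close>, \<open>\<rho> g\<close> keeps it there, and \<open>Q\<close> kills the
    coordinates from \<open>k\<close> on.\<close>
  have Rlow: "R g $$ (i, j) = 0" if g: "g \<in> carrier G" and ij: "j < k" "k \<le> i" "i < n" for g i j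
  proof -
    note [simp] = \<rho>(1)[OF g]
    have "col (R g) j = R g *\<^sub>v unit_vec n j" using ij k R[OF g]
      by (intro eq_vecI) (auto simp: scalar_prod_right_unit)
    also have "\<dots> = Q *\<^sub>v (\<rho> g *\<^sub>v (P *\<^sub>v unit_vec n j))"
      by (simp add: R_def assoc_mult_mat_vec[of _ n n _ n] mult_mat_vec_carrier[of _ n n])
    also have "P *\<^sub>v unit_vec n j = col P j" using ij k carrier_matD[OF kPQ(2)]
      by (intro eq_vecI) (auto simp: scalar_prod_right_unit)
    finally have "col (R g) j $ i = 0" using kPQ(7)[of "\<rho> g *\<^sub>v col P j" i] kPQ(6) inv g ij by simp
    then show ?thesis using ij k carrier_matD[OF R[OF g]] by simp
  qed
  define \<sigma> where "\<sigma> = (\<lambda>g. mat k k (\<lambda>ij. R g $$ ij))"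
  define \<tau> where "\<tau> = (\<lambda>g. mat (n - k) (n - k) (\<lambda>(i, j). R g $$ (i + k, j + k)))"
  have split: "(\<Sum>m<n. f m) = (\<Sum>m<k. f m) + (\<Sum>m<n - k. f (m + k))" for f :: "nat \<Rightarrow> complex"
  proof -
    have "(\<Sum>m<n. f m) = (\<Sum>m=0..<k. f m) + (\<Sum>m=k..<n. f m)"
      using k by (simp add: sum.atLeastLessThan_concat lessThan_atLeast0)
    moreover have "(\<Sum>m=k..<n. f m) = (\<Sum>m=0..<n - k. f (m + k))"
      using k sum.shift_bounds_nat_ivl[of f 0 k "n - k"] by simp
    ultimately show ?thesis by (simp add: lessThan_atLeast0)
  qed
  have 1: "representation G k \<sigma>"
    unfolding representation_iff[OF G]
  proof (intro conjI ballI)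
    fix g h assume gh: "g \<in> carrier G" "h \<in> carrier G"
    show "\<sigma> (g \<otimes>\<^bsub>G\<^esub> h) = \<sigma> g * \<sigma> h"
    proof (rule eq_matI)
      fix i j assume "i < dim_row (\<sigma> g * \<sigma> h)" "j < dim_col (\<sigma> g * \<sigma> h)"
      then have ij: "i < k" "j < k" by (auto simp: \<sigma>_def)
      have "\<sigma> (g \<otimes>\<^bsub>G\<^esub> h) $$ (i, j) = (\<Sum>m<n. R g $$ (i, m) * R h $$ (m, j))"
        using ij k gh by (simp add: \<sigma>_def Rmult index_mult_mat_sum[of _ n n _ n] del: index_mult_mat(1))
      also have "\<dots> = (\<Sum>m<k. R g $$ (i, m) * R h $$ (m, j))"
        unfolding split using ij gh by (simp add: Rlow)
      also have "\<dots> = (\<sigma> g * \<sigma> h) $$ (i, j)"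
        using ij by (simp add: \<sigma>_def index_mult_mat_sum[of _ k k _ k] del: index_mult_mat(1))
      finally show "\<sigma> (g \<otimes>\<^bsub>G\<^esub> h) $$ (i, j) = (\<sigma> g * \<sigma> h) $$ (i, j)" .
    qed (auto simp: \<sigma>_def)
  qed (use k Rone in \<open>auto simp: \<sigma>_def\<close>)
  have 2: "representation G (n - k) \<tau>"
    unfolding representation_iff[OF G]
  proof (intro conjI ballI)
    fix g h assume gh: "g \<in> carrier G" "h \<in> carrier G"
    show "\<tau> (g \<otimes>\<^bsub>G\<^esub> h) = \<tau> g * \<tau> h"
    proof (rule eq_matI)
      fix i j assume "i < dim_row (\<tau> g * \<tau> h)" "j < dim_col (\<tau> g * \<tau> h)"
      then have ij: "i < n - k" "j < n - k" by (auto simp: \<tau>_def)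
      have "\<tau> (g \<otimes>\<^bsub>G\<^esub> h) $$ (i, j) = (\<Sum>m<n. R g $$ (i + k, m) * R h $$ (m, j + k))"
        using ij k gh by (simp add: \<tau>_def Rmult index_mult_mat_sum[of _ n n _ n] del: index_mult_mat(1))
      also have "\<dots> = (\<Sum>m<n - k. R g $$ (i + k, m + k) * R h $$ (m + k, j + k))"
        unfolding split using ij gh by (simp add: Rlow)
      also have "\<dots> = (\<tau> g * \<tau> h) $$ (i, j)"
        using ij by (simp add: \<tau>_def index_mult_mat_sum[of _ "n - k" "n - k" _ "n - k"] del: index_mult_mat(1))
      finally show "\<tau> (g \<otimes>\<^bsub>G\<^esub> h) $$ (i, j) = (\<tau> g * \<tau> h) $$ (i, j)" .
    qed (auto simp: \<tau>_def)
  qed (use k Rone in \<open>auto simp: \<tau>_def\<close>)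
  have 3: "mat_trace (\<rho> g) = mat_trace (\<sigma> g) + mat_trace (\<tau> g)" if g: "g \<in> carrier G" for g
  proof -
    note [simp] = \<rho>(1)[OF g]
    have "mat_trace (R g) = mat_trace (Q * (\<rho> g * P))" by (simp add: R_def assoc_mult_mat[of _ n n _ n _ n])
    also have "\<dots> = mat_trace ((\<rho> g * P) * Q)" by (rule mat_trace_comm[of _ n n]) simp_all
    also have "\<dots> = mat_trace (\<rho> g)"
      by (simp add: assoc_mult_mat[of _ n n _ n _ n] kPQ(4) right_mult_one_mat[of _ n n])
    finally have "mat_trace (\<rho> g) = (\<Sum>i<n. R g $$ (i, i))"
      using mat_trace_carrier[OF R[OF g]] by simp
    then show ?thesis unfolding split by (simp add: mat_trace_def \<sigma>_def \<tau>_def)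
  qed
  show ?thesis using that[OF _ _ 1 2 3] k by simp
qed

text \<open>Strong induction on the degree: a reducible representation of positive degree splits
  along an invariant subspace. Degree zero, which is not irreducible by definition, yields the empty
  multiset.\<close>

lemma representation_decomposition:
  assumes G: "group G"
  shows "representation G n \<rho> \<Longrightarrow>
    \<exists>M. set_mset M \<subseteq> Irr G \<and> (\<forall>g\<in>carrier G. mat_trace (\<rho> g) = (\<Sum>\<theta>\<in>#M. \<theta> g))"
proof (induction n arbitrary: \<rho> rule: less_induct)
  case (less n)
  consider "n = 0" | "irreducible_representation G n \<rho>"
    | "n > 0" "\<not> irreducible_representation G n \<rho>" by blast
  then show ?case
  proof cases
    case 1
    then have "mat_trace (\<rho> g) = 0" if "g \<in> carrier G" for g
      using less.prems that by (auto simp: representation_iff[OF G] mat_trace_def)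
    then show ?thesis by (intro exI[of _ "{#}"]) auto
  next
    case 2
    then have "rep_character G \<rho> \<in> Irr G" by (auto simp: Irr_def)
    then show ?thesis by (intro exI[of _ "{#rep_character G \<rho>#}"]) (auto simp: rep_character_def)
  next
    case 3
    then obtain W where W: "VectorSpace.subspace class_ring W (module_vec TYPE(complex) n)"
      "\<forall>g\<in>carrier G. \<forall>w\<in>W. \<rho> g *\<^sub>v w \<in> W" "W \<noteq> {0\<^sub>v n}" "W \<noteq> carrier_vec n"
      using less.prems unfolding irreducible_representation_def by blast
    obtain k \<sigma> \<tau> where *: "k < n" "n - k < n" "representation G k \<sigma>" "representation G (n - k) \<tau>"
      "\<And>g. g \<in> carrier G \<Longrightarrow> mat_trace (\<rho> g) = mat_trace (\<sigma> g) + mat_trace (\<tau> g)"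
      using invariant_subspace_splits_trace[OF G less.prems W] by blast
    obtain M1 M2 where "set_mset M1 \<subseteq> Irr G" "\<forall>g\<in>carrier G. mat_trace (\<sigma> g) = (\<Sum>\<theta>\<in>#M1. \<theta> g)"
      "set_mset M2 \<subseteq> Irr G" "\<forall>g\<in>carrier G. mat_trace (\<tau> g) = (\<Sum>\<theta>\<in>#M2. \<theta> g)"
      using less.IH[OF *(1,3)] less.IH[OF *(2,4)] by blast
    then show ?thesis using * by (intro exI[of _ "M1 + M2"]) auto
  qed
qed

text \<open>The tensor product of matrices. A pair \<open>(a, b)\<close> of row indices is encoded
  as \<open>a * dim_row B + b\<close>, so that \<open>div\<close> and \<open>mod\<close> recover it;
  columns are treated alike.\<close>

definition kronecker :: "complex mat \<Rightarrow> complex mat \<Rightarrow> complex mat" where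
  "kronecker A B = mat (dim_row A * dim_row B) (dim_col A * dim_col B)
    (\<lambda>(i, j). A $$ (i div dim_row B, j div dim_col B) * B $$ (i mod dim_row B, j mod dim_col B))"

lemma sum_div_mod:
  fixes f :: "nat \<Rightarrow> nat \<Rightarrow> 'a :: comm_monoid_add"
  shows "(\<Sum>i<n * m. f (i div m) (i mod m)) = (\<Sum>i<n. \<Sum>j<m. f i j)"
proof -
  have bnd: "i * m + j < n * m" if "i < n" "j < m" for i j
  proof -
    have "i * m + j < Suc i * m" using that by simp
    also have "\<dots> \<le> n * m" using that by (intro mult_right_mono) auto
    finally show ?thesis .
  qed
  have "(\<Sum>i<n * m. f (i div m) (i mod m)) = (\<Sum>(i, j)\<in>{..<n} \<times> {..<m}. f i j)"
    by (rule sum.reindex_bij_witness[where i = "\<lambda>(i, j). i * m + j" and j = "\<lambda>i. (i div m, i mod m)"])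
      (auto simp: less_mult_imp_div_less intro!: mod_less_divisor Nat.gr0I dest: bnd)
  then show ?thesis by (simp add: sum.cartesian_product)
qed

lemma mat_trace_kronecker:
  assumes "A \<in> carrier_mat n n" "B \<in> carrier_mat m m"
  shows "mat_trace (kronecker A B) = mat_trace A * mat_trace B"
  using assms sum_div_mod[of "\<lambda>i j. A $$ (i, i) * B $$ (j, j)" m n]
  by (simp add: mat_trace_def kronecker_def sum_product)

lemma kronecker_mult:
  assumes A: "A \<in> carrier_mat n n" "A' \<in> carrier_mat n n"
    and B: "B \<in> carrier_mat m m" "B' \<in> carrier_mat m m"
  shows "kronecker (A * A') (B * B') = kronecker A B * kronecker A' B'"
proof (rule eq_matI)
  have K: "kronecker A B \<in> carrier_mat (n * m) (n * m)" "kronecker A' B' \<in> carrier_mat (n * m) (n * m)"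
    using assms by (auto simp: kronecker_def)
  fix i j assume "i < dim_row (kronecker A B * kronecker A' B')" "j < dim_col (kronecker A B * kronecker A' B')"
  then have ij: "i < n * m" "j < n * m" using K by auto
  then have m: "m > 0" by (auto intro: Nat.gr0I)
  have ij': "i div m < n" "j div m < n" "i mod m < m" "j mod m < m"
    using ij m by (auto simp: less_mult_imp_div_less)
  have "(kronecker A B * kronecker A' B') $$ (i, j)
      = (\<Sum>k<n * m. kronecker A B $$ (i, k) * kronecker A' B' $$ (k, j))"
    by (rule index_mult_mat_sum[OF K ij])
  also have "\<dots> = (\<Sum>k<n * m. (A $$ (i div m, k div m) * A' $$ (k div m, j div m)) *
      (B $$ (i mod m, k mod m) * B' $$ (k mod m, j mod m)))"
    using assms ij by (intro sum.cong) (auto simp: kronecker_def)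
  also have "\<dots> = (\<Sum>k<n. \<Sum>l<m. (A $$ (i div m, k) * A' $$ (k, j div m)) *
      (B $$ (i mod m, l) * B' $$ (l, j mod m)))"
    by (rule sum_div_mod)
  also have "\<dots> = (A * A') $$ (i div m, j div m) * (B * B') $$ (i mod m, j mod m)"
    unfolding index_mult_mat_sum[OF A ij'(1,2)] index_mult_mat_sum[OF B ij'(3,4)] by (simp add: sum_product)
  also have "\<dots> = kronecker (A * A') (B * B') $$ (i, j)"
    using assms ij by (simp add: kronecker_def del: index_mult_mat(1))
  finally show "kronecker (A * A') (B * B') $$ (i, j) = (kronecker A B * kronecker A' B') $$ (i, j)" by simp
qed (use assms in \<open>auto simp: kronecker_def\<close>)

lemma representation_kronecker:
  assumes G: "group G" and "representation G n \<rho>" "representation G m \<sigma>"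
  shows "representation G (n * m) (\<lambda>g. kronecker (\<rho> g) (\<sigma> g))"
proof -
  have one: "kronecker (1\<^sub>m n) (1\<^sub>m m) = 1\<^sub>m (n * m)"
  proof (rule eq_matI)
    fix i j assume "i < dim_row (1\<^sub>m (n * m) :: complex mat)" "j < dim_col (1\<^sub>m (n * m) :: complex mat)"
    then have ij: "i < n * m" "j < n * m" by auto
    then have m: "m > 0" by (auto intro: Nat.gr0I)
    moreover have "i = j" if "i div m = j div m" "i mod m = j mod m"
      using that by (metis div_mult_mod_eq)
    ultimately show "kronecker (1\<^sub>m n) (1\<^sub>m m) $$ (i, j) = 1\<^sub>m (n * m) $$ (i, j)"
      using ij by (auto simp: kronecker_def less_mult_imp_div_less)
  qed (auto simp: kronecker_def)
  have "kronecker (\<rho> g) (\<sigma> g) \<in> carrier_mat (n * m) (n * m)" if "g \<in> carrier G" for g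
  proof -
    have "\<rho> g \<in> carrier_mat n n" "\<sigma> g \<in> carrier_mat m m"
      using assms that by (auto simp: representation_iff[OF G])
    then show ?thesis by (simp add: kronecker_def)
  qed
  then show ?thesis
    using assms one by (auto simp: representation_iff[OF G] kronecker_mult[of _ n _ _ m])
qed

text \<open>The product of the characters is the trace of the tensor product representation, to
  which the decomposition applies.\<close>

lemma Irr_mult_decomposition:
  assumes G: "group G" and "\<chi> \<in> Irr G" "\<psi> \<in> Irr G"
  obtains M where "irr_decomposition G (\<lambda>g. \<chi> g * \<psi> g) M"
proof -
  obtain n \<rho> m \<sigma> where irr: "irreducible_representation G n \<rho>" "irreducible_representation G m \<sigma>"
    and \<chi>: "\<chi> = rep_character G \<rho>" "\<psi> = rep_character G \<sigma>"
    using assms by (auto simp: Irr_def)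
  have "representation G n \<rho>" "representation G m \<sigma>"
    using irr by (simp_all add: irreducible_representation_def)
  from representation_decomposition[OF G representation_kronecker[OF G this]]
  obtain M where "set_mset M \<subseteq> Irr G"
    "\<forall>g\<in>carrier G. mat_trace (kronecker (\<rho> g) (\<sigma> g)) = (\<Sum>\<theta>\<in>#M. \<theta> g)"
    by blast
  moreover have "mat_trace (kronecker (\<rho> g) (\<sigma> g)) = mat_trace (\<rho> g) * mat_trace (\<sigma> g)"
    if "g \<in> carrier G" for g
    using mat_trace_kronecker[OF irr_rep_carrier[OF G irr(1) that] irr_rep_carrier[OF G irr(2) that]] .
  ultimately have "irr_decomposition G (\<lambda>g. \<chi> g * \<psi> g) M"
    by (auto simp: irr_decomposition_def \<chi> rep_character_def)
  then show ?thesis by (rule that)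
qed

section \<open>Irreducible characters\<close>

lemma sum_mset_eq_sum_count:
  fixes f :: "'a \<Rightarrow> 'b :: comm_semiring_1"
  shows "(\<Sum>x\<in>#M. f x) = (\<Sum>x\<in>set_mset M. of_nat (count M x) * f x)"
proof (induction M)
  case (add a M)
  have "(\<Sum>x\<in>set_mset (add_mset a M). of_nat (count (add_mset a M) x) * f x)
      = (\<Sum>x\<in>insert a (set_mset M). of_nat (count M x) * f x + (if x = a then f x else 0))"
    by (intro sum.cong) (auto simp: algebra_simps)
  also have "\<dots> = (\<Sum>x\<in>insert a (set_mset M). of_nat (count M x) * f x) + f a"
    by (simp add: sum.distrib)
  also have "(\<Sum>x\<in>insert a (set_mset M). of_nat (count M x) * f x)
      = (\<Sum>x\<in>set_mset M. of_nat (count M x) * f x)"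
    by (intro sum.mono_neutral_right) (auto simp: not_in_iff)
  finally show ?case using add.IH by (simp add: add.commute)
qed simp

section \<open>Character identities and orthogonality in a finite group\<close>

locale fin_group = group +
  assumes finite_carrier: "finite (carrier G)"
begin

definition conj_class :: "'a \<Rightarrow> 'a set" where
  "conj_class x = (\<lambda>g. g \<otimes> x \<otimes> inv g) ` carrier G"

text \<open>An unnormalised inner product over a subset. Evaluating \<open>\<beta>\<close> at
  inverses replaces complex conjugation, which keeps the pairing bilinear and the arguments
  algebraic.\<close>

definition char_pairing :: "'a set \<Rightarrow> ('a \<Rightarrow> complex) \<Rightarrow> ('a \<Rightarrow> complex) \<Rightarrow> complex" where
  "char_pairing X \<alpha> \<beta> = (\<Sum>x\<in>X. \<alpha> x * \<beta> (inv x))"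

lemma Irr_degree:
  assumes "\<theta> \<in> Irr G"
  obtains n where "n > 0" "\<theta> \<one> = of_nat n"
proof -
  obtain n \<rho> where irr: "irreducible_representation G n \<rho>" "\<theta> = rep_character G \<rho>"
    using assms by (auto simp: Irr_def)
  show ?thesis
    using that[OF irr_rep_dim[OF is_group irr(1)]] irr_rep_one[OF is_group irr(1)] irr(2)
    by (simp add: rep_character_def mat_trace_def)
qed

lemma Irr_degree_nonzero [simp]: "\<theta> \<in> Irr G \<Longrightarrow> \<theta> \<one> \<noteq> 0"
  by (metis Irr_degree of_nat_0_eq_iff less_irrefl)

lemma Irr_ext:
  assumes "\<theta> \<in> Irr G" "\<theta>' \<in> Irr G" "\<And>x. x \<in> carrier G \<Longrightarrow> \<theta> x = \<theta>' x"
  shows "\<theta> = \<theta>'"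
  using assms by (auto simp: Irr_def rep_character_def)

lemma Irr_commute:
  assumes "\<theta> \<in> Irr G" "x \<in> carrier G" "y \<in> carrier G"
  shows "\<theta> (x \<otimes> y) = \<theta> (y \<otimes> x)"
proof -
  obtain n \<rho> where irr: "irreducible_representation G n \<rho>" "\<theta> = rep_character G \<rho>"
    using assms by (auto simp: Irr_def)
  note rep = irr_rep_carrier[OF is_group irr(1)] irr_rep_mult[OF is_group irr(1)]
  show ?thesis using assms irr mat_trace_comm[OF rep(1)[OF assms(2)] rep(1)[OF assms(3)]]
    by (simp add: rep_character_def rep)
qed

lemma Irr_conjugate:
  assumes "\<theta> \<in> Irr G" "g \<in> carrier G" "x \<in> carrier G"
  shows "\<theta> (g \<otimes> x \<otimes> inv g) = \<theta> x"
  using Irr_commute[of \<theta> "g \<otimes> x" "inv g"] assms by (simp flip: m_assoc)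

text \<open>Schur's lemma in the form used from here on. It is applied to singletons of central
  elements, conjugacy classes, normal subgroups and cosets, with \<open>F\<close> constant or the
  dual of a character.\<close>

lemma Irr_class_sum:
  assumes \<theta>: "\<theta> \<in> Irr G" and X: "X \<subseteq> carrier G" and y: "y \<in> carrier G"
    and "\<And>g u. g \<in> carrier G \<Longrightarrow> u \<in> X \<Longrightarrow> g \<otimes> u \<otimes> inv g \<in> X"
    and "\<And>g u. g \<in> carrier G \<Longrightarrow> u \<in> X \<Longrightarrow> F (g \<otimes> u \<otimes> inv g) = F u"
  shows "\<theta> \<one> * (\<Sum>u\<in>X. F u * \<theta> (u \<otimes> y)) = (\<Sum>u\<in>X. F u * \<theta> u) * \<theta> y"
proof -
  obtain n \<rho> where irr: "irreducible_representation G n \<rho>" and eq: "\<theta> = rep_character G \<rho>"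
    using \<theta> by (auto simp: Irr_def)
  have "\<theta> \<one> = of_nat n" using irr_rep_one[OF is_group irr] eq by (simp add: rep_character_def mat_trace_def)
  moreover have "(\<Sum>u\<in>X. F u * \<theta> (u \<otimes> y)) = (\<Sum>u\<in>X. F u * mat_trace (\<rho> (u \<otimes> y)))"
    using X y by (intro sum.cong) (auto simp: eq rep_character_def)
  moreover have "(\<Sum>u\<in>X. F u * \<theta> u) = (\<Sum>u\<in>X. F u * mat_trace (\<rho> u))"
    using X by (intro sum.cong) (auto simp: eq rep_character_def)
  moreover have "\<theta> y = mat_trace (\<rho> y)" using y by (simp add: eq rep_character_def)
  ultimately show ?thesis using irr_rep_class_sum[where F = F, OF is_group irr X y assms(4,5)] by simp
qed

lemma Irr_norm:
  assumes \<theta>: "\<theta> \<in> Irr G"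
  shows "char_pairing (carrier G) \<theta> \<theta> = of_nat (card (carrier G))"
proof -
  obtain n \<rho> where irr: "irreducible_representation G n \<rho>" and eq: "\<theta> = rep_character G \<rho>"
    using \<theta> by (auto simp: Irr_def)
  show ?thesis using irr_rep_norm[OF is_group irr finite_carrier] by (simp add: char_pairing_def eq rep_character_def)
qed

text \<open>Clifford's theorem in terms of characters: Schur's lemma evaluates the convolution of the two
  restrictions as a multiple of either of them.\<close>

lemma Irr_proportional_on_normal:
  assumes X: "X \<lhd> G" and \<theta>: "\<theta> \<in> Irr G" and \<theta>': "\<theta>' \<in> Irr G"
    and s: "char_pairing X \<theta> \<theta>' \<noteq> 0" and y: "y \<in> X"
  shows "\<theta> y * \<theta>' \<one> = \<theta>' y * \<theta> \<one>"
proof -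
  interpret X: normal X G by (rule X)
  have Xc: "X \<subseteq> carrier G" by (rule X.subset)
  have yc: "y \<in> carrier G" using y Xc by auto
  have conj: "g \<otimes> u \<otimes> inv g \<in> X" if "g \<in> carrier G" "u \<in> X" for g u
    using X.inv_op_closed2 that by blast
  have inv_conj: "inv (g \<otimes> u \<otimes> inv g) = g \<otimes> inv u \<otimes> inv g" if "g \<in> carrier G" "u \<in> X" for g u
    using that Xc by (auto simp: inv_mult_group m_assoc)
  have fc: "\<alpha> (inv (g \<otimes> u \<otimes> inv g)) = \<alpha> (inv u)" if "\<alpha> \<in> Irr G" "g \<in> carrier G" "u \<in> X" for \<alpha> g u
    using inv_conj[OF that(2,3)] Irr_conjugate[OF that(1,2), of "inv u"] that Xc by auto
  \<comment> \<open>The convolution of \<open>\<theta>\<close> with the dual of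
    \<open>\<theta>'\<close> is a multiple of \<open>\<theta>\<close>. Exchanging the roles of the
    two characters gives a multiple of \<open>\<theta>'\<close> with the same factor.\<close>
  have 1: "\<theta> \<one> * (\<Sum>u\<in>X. \<theta>' (inv u) * \<theta> (u \<otimes> y)) = char_pairing X \<theta> \<theta>' * \<theta> y"
    using Irr_class_sum[where F = "\<lambda>u. \<theta>' (inv u)", OF \<theta> Xc yc conj fc[OF \<theta>']]
    by (simp add: char_pairing_def mult.commute)
  have "\<theta>' \<one> * (\<Sum>u\<in>X. \<theta> (inv u) * \<theta>' (u \<otimes> y)) = (\<Sum>u\<in>X. \<theta> (inv u) * \<theta>' u) * \<theta>' y"
    by (rule Irr_class_sum[where F = "\<lambda>u. \<theta> (inv u)", OF \<theta>' Xc yc conj fc[OF \<theta>]])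
  also have "(\<Sum>u\<in>X. \<theta> (inv u) * \<theta>' u) = char_pairing X \<theta> \<theta>'"
    unfolding char_pairing_def
    by (rule sum.reindex_bij_witness[where i = "\<lambda>u. inv u" and j = "\<lambda>u. inv u"]) (use Xc in auto)
  \<comment> \<open>The two convolutions agree after substituting
    \<open>inv u \<otimes> inv y\<close> for \<open>u\<close> on the right, because
    \<open>\<theta>'\<close> takes equal values at \<open>y \<otimes> u\<close> and
    \<open>u \<otimes> y\<close>.\<close>
  also have "(\<Sum>u\<in>X. \<theta> (inv u) * \<theta>' (u \<otimes> y)) = (\<Sum>u\<in>X. \<theta>' (inv u) * \<theta> (u \<otimes> y))"
  proof (rule sum.reindex_bij_witness[where i = "\<lambda>u. inv (u \<otimes> y)" and j = "\<lambda>u. inv u \<otimes> inv y"])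
    fix u assume u: "u \<in> X"
    then have uc: "u \<in> carrier G" using Xc by auto
    show "inv (inv u \<otimes> inv y \<otimes> y) = u" "inv (inv (u \<otimes> y)) \<otimes> inv y = u"
      using uc yc by (simp_all add: m_assoc)
    show "inv u \<otimes> inv y \<in> X" "inv (u \<otimes> y) \<in> X" using u y by auto
    have "inv (inv u \<otimes> inv y) = y \<otimes> u" "inv u \<otimes> inv y \<otimes> y = inv u"
      using uc yc by (simp_all add: inv_mult_group m_assoc)
    then show "\<theta>' (inv (inv u \<otimes> inv y)) * \<theta> (inv u \<otimes> inv y \<otimes> y) = \<theta> (inv u) * \<theta>' (u \<otimes> y)"
      using Irr_commute[OF \<theta>' yc uc] by simp
  qed
  finally have 2: "\<theta>' \<one> * (\<Sum>u\<in>X. \<theta>' (inv u) * \<theta> (u \<otimes> y)) = char_pairing X \<theta> \<theta>' * \<theta>' y" .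
  have "char_pairing X \<theta> \<theta>' * (\<theta> y * \<theta>' \<one>) = (char_pairing X \<theta> \<theta>' * \<theta> y) * \<theta>' \<one>"
    by (simp only: mult.assoc)
  also have "\<dots> = (\<theta>' \<one> * (\<Sum>u\<in>X. \<theta>' (inv u) * \<theta> (u \<otimes> y))) * \<theta> \<one>"
    unfolding 1[symmetric] by (simp only: mult_ac)
  also have "\<dots> = char_pairing X \<theta> \<theta>' * (\<theta>' y * \<theta> \<one>)"
    unfolding 2 by (simp only: mult_ac)
  finally have "char_pairing X \<theta> \<theta>' * (\<theta> y * \<theta>' \<one>) = char_pairing X \<theta> \<theta>' * (\<theta>' y * \<theta> \<one>)" .
  then show ?thesis using s by simp
qed

text \<open>A nonzero pairing would make the characters proportional, by Clifford's theorem for the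
  whole group as normal subgroup. Equal norms then force equal degrees, hence equality.\<close>

lemma Irr_orthogonal:
  assumes \<theta>: "\<theta> \<in> Irr G" and \<theta>': "\<theta>' \<in> Irr G" and "\<theta> \<noteq> \<theta>'"
  shows "char_pairing (carrier G) \<theta> \<theta>' = 0"
proof (rule ccontr)
  assume "char_pairing (carrier G) \<theta> \<theta>' \<noteq> 0"
  moreover have "carrier G \<lhd> G" by (rule normal_invI[OF subgroup_self]) auto
  ultimately
  have proportional: "\<theta> y * \<theta>' \<one> = \<theta>' y * \<theta> \<one>" if "y \<in> carrier G" for y
    using that Irr_proportional_on_normal[OF _ \<theta> \<theta>'] by blast
  obtain n m where n: "\<theta> \<one> = of_nat n" "\<theta>' \<one> = of_nat m" using Irr_degree \<theta> \<theta>' by metis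
  have "char_pairing (carrier G) \<theta> \<theta> * (\<theta>' \<one>)\<^sup>2 = (\<Sum>x\<in>carrier G. (\<theta> x * \<theta>' \<one>) * (\<theta> (inv x) * \<theta>' \<one>))"
    by (simp add: char_pairing_def sum_distrib_left sum_distrib_right power2_eq_square mult_ac)
  also have "\<dots> = (\<Sum>x\<in>carrier G. (\<theta>' x * \<theta> \<one>) * (\<theta>' (inv x) * \<theta> \<one>))"
    by (intro sum.cong) (simp_all add: proportional)
  also have "\<dots> = char_pairing (carrier G) \<theta>' \<theta>' * (\<theta> \<one>)\<^sup>2"
    by (simp add: char_pairing_def sum_distrib_left sum_distrib_right power2_eq_square mult_ac)
  finally have "(\<theta>' \<one>)\<^sup>2 = (\<theta> \<one>)\<^sup>2"
    using finite_carrier one_closed by (auto simp: Irr_norm \<theta> \<theta>' card_eq_0_iff)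
  then have "complex_of_nat (m\<^sup>2) = of_nat (n\<^sup>2)" by (simp add: n)
  then have "m = n" by (simp only: of_nat_eq_iff power2_eq_iff_nonneg zero_le)
  then have "\<theta> = \<theta>'" using proportional n \<theta> \<theta>' Irr_degree_nonzero[OF \<theta>] by (intro Irr_ext) auto
  with assms show False by simp
qed

text \<open>Orthogonality leaves only the summand \<open>\<theta>\<close>. Multiplicities are
  thereby recovered from \<open>\<phi>\<close>, which yields uniqueness of the
  decomposition.\<close>

lemma irr_decomposition_coefficient:
  assumes M: "irr_decomposition G \<phi> M" and \<theta>: "\<theta> \<in> Irr G"
  shows "char_pairing (carrier G) \<phi> \<theta> = of_nat (count M \<theta>) * of_nat (card (carrier G))"
proof -
  have "char_pairing (carrier G) \<phi> \<theta>
      = (\<Sum>x\<in>carrier G. \<Sum>\<alpha>\<in>set_mset M. of_nat (count M \<alpha>) * (\<alpha> x * \<theta> (inv x)))"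
    using M by (simp add: char_pairing_def irr_decomposition_def sum_mset_eq_sum_count sum_distrib_right mult.assoc)
  also have "\<dots> = (\<Sum>\<alpha>\<in>set_mset M. of_nat (count M \<alpha>) * char_pairing (carrier G) \<alpha> \<theta>)"
    by (subst sum.swap) (simp add: char_pairing_def sum_distrib_left)
  also have "\<dots> = (\<Sum>\<alpha>\<in>set_mset M. if \<alpha> = \<theta> then of_nat (count M \<theta>) * of_nat (card (carrier G)) else 0)"
    using M \<theta> by (intro sum.cong) (auto simp: irr_decomposition_def Irr_norm Irr_orthogonal)
  also have "\<dots> = of_nat (count M \<theta>) * of_nat (card (carrier G))"
    by (auto simp: not_in_iff)
  finally show ?thesis .
qed

lemma irr_decomposition_unique:
  assumes M: "irr_decomposition G \<phi> M" and N: "irr_decomposition G \<phi> N"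
  shows "M = N"
proof (rule multiset_eqI)
  fix \<theta>
  show "count M \<theta> = count N \<theta>"
  proof (cases "\<theta> \<in> Irr G")
    case True
    have "of_nat (count M \<theta>) * of_nat (card (carrier G)) = (of_nat (count N \<theta>) * of_nat (card (carrier G)) :: complex)"
      by (rule trans[OF irr_decomposition_coefficient[OF M True, symmetric]
            irr_decomposition_coefficient[OF N True]])
    moreover have "card (carrier G) \<noteq> 0" using finite_carrier one_closed by (auto simp: card_eq_0_iff)
    ultimately show ?thesis by simp
  next
    case False
    then have "\<theta> \<notin># M" "\<theta> \<notin># N" using M N by (auto simp: irr_decomposition_def)
    then show ?thesis by (simp add: not_in_iff)
  qed
qed

text \<open>Uniqueness resolves the definite description in \<open>char_multiplicity\<close>, so
  constituents can be counted in any decomposition at hand.\<close>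

lemma eta_eq_card:
  assumes "irr_decomposition G (\<lambda>g. \<chi> g * \<psi> g) M"
  shows "eta G \<chi> \<psi> = card (set_mset M)"
proof -
  have "(THE M. irr_decomposition G (\<lambda>g. \<chi> g * \<psi> g) M) = M"
    using assms irr_decomposition_unique by blast
  then have "irr_constituents G (\<lambda>g. \<chi> g * \<psi> g) = set_mset M"
    using assms by (auto simp: irr_constituents_def char_multiplicity_def irr_decomposition_def)
  then show ?thesis by (simp add: eta_def)
qed

text \<open>The pairings of the constituents over \<open>X\<close> are nonnegative, so dropping the off-diagonal
  ones leaves a sum of squares to which Cauchy-Schwarz applies.\<close>

lemma card_constituents_bound:
  assumes X: "X \<lhd> G" and M: "irr_decomposition G \<phi> M" and nz: "\<phi> \<one> \<noteq> 0"
    and w: "\<And>x. x \<in> X \<Longrightarrow> w x \<ge> (0 :: real)"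
    and wM: "\<And>\<theta> x. \<theta> \<in># M \<Longrightarrow> x \<in> X \<Longrightarrow> \<theta> x * \<theta> (inv x) = of_real (w x) * (\<theta> \<one>)\<^sup>2"
    and v: "\<And>x. x \<in> X \<Longrightarrow> \<phi> x * \<phi> (inv x) = of_real (v x) * (\<phi> \<one>)\<^sup>2"
  shows "(\<Sum>x\<in>X. w x) \<le> real (card (set_mset M)) * (\<Sum>x\<in>X. v x)"
proof -
  interpret X: normal X G by (rule X)
  have Xc: "X \<subseteq> carrier G" by (rule X.subset)
  let ?S = "set_mset M"
  define W where "W = (\<Sum>x\<in>X. w x)"
  have W: "W \<ge> 0" unfolding W_def using w by (intro sum_nonneg) auto
  have SI: "\<theta> \<in> Irr G" if "\<theta> \<in> ?S" for \<theta> using M that by (auto simp: irr_decomposition_def)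
  define d where "d = (\<lambda>\<theta> :: 'a \<Rightarrow> complex. Re (\<theta> \<one>))"
  have d: "\<theta> \<one> = of_real (d \<theta>)" "d \<theta> > 0" if \<theta>: "\<theta> \<in> ?S" for \<theta>
  proof -
    obtain n where "n > 0" "\<theta> \<one> = of_nat n" using Irr_degree[OF SI[OF \<theta>]] .
    then show "\<theta> \<one> = of_real (d \<theta>)" "d \<theta> > 0" by (simp_all add: d_def)
  qed
  define a where "a = (\<lambda>\<theta>. real (count M \<theta>))"
  define D where "D = (\<Sum>\<theta>\<in>?S. a \<theta> * d \<theta>)"
  have \<phi>: "\<phi> x = (\<Sum>\<theta>\<in>?S. of_real (a \<theta>) * \<theta> x)" if "x \<in> carrier G" for x
    using M that by (simp add: irr_decomposition_def sum_mset_eq_sum_count a_def)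
  have D: "\<phi> \<one> = of_real D" by (simp add: \<phi> D_def d)
  have diag: "char_pairing X \<theta> \<theta> = of_real ((d \<theta>)\<^sup>2 * W)" if "\<theta> \<in> ?S" for \<theta>
    by (simp add: char_pairing_def wM[OF that] W_def d(1)[OF that] mult.commute sum_distrib_right)
  \<comment> \<open>Characters with nonzero pairing over \<open>X\<close> are proportional there, so
    the pairing equals \<open>d \<theta> * W * d \<theta>'\<close>, which is nonnegative.\<close>
  have pair: "\<exists>r\<ge>0. char_pairing X \<theta> \<theta>' = of_real r" if \<theta>: "\<theta> \<in> ?S" and \<theta>': "\<theta>' \<in> ?S" for \<theta> \<theta>'
  proof (cases "char_pairing X \<theta> \<theta>' = 0")
    case False
    have "\<theta>' (inv x) * \<theta> \<one> = \<theta> (inv x) * \<theta>' \<one>" if "x \<in> X" for x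
      using Irr_proportional_on_normal[OF X SI[OF \<theta>] SI[OF \<theta>'] False, of "inv x"] that by simp
    then have "char_pairing X \<theta> \<theta>' * \<theta> \<one> = char_pairing X \<theta> \<theta> * \<theta>' \<one>"
      unfolding char_pairing_def sum_distrib_right by (intro sum.cong) (simp_all add: mult.assoc)
    then have "char_pairing X \<theta> \<theta>' = of_real (d \<theta> * W * d \<theta>')"
      using d[OF \<theta>] d[OF \<theta>'] diag[OF \<theta>] by (simp add: field_simps power2_eq_square)
    then show ?thesis using d[OF \<theta>] d[OF \<theta>'] W by (intro exI[of _ "d \<theta> * W * d \<theta>'"]) auto
  qed (auto intro: exI[of _ 0])
  define r where "r = (\<lambda>\<theta> \<theta>'. Re (char_pairing X \<theta> \<theta>'))"
  have r: "char_pairing X \<theta> \<theta>' = of_real (r \<theta> \<theta>')" "r \<theta> \<theta>' \<ge> 0" if "\<theta> \<in> ?S" "\<theta>' \<in> ?S" for \<theta> \<theta>'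
    using pair[OF that] by (auto simp: r_def)
  have rd: "r \<theta> \<theta> = (d \<theta>)\<^sup>2 * W" if "\<theta> \<in> ?S" for \<theta> using diag[OF that] by (simp add: r_def)
  have "char_pairing X \<phi> \<phi> = (\<Sum>x\<in>X. \<Sum>\<theta>\<in>?S. \<Sum>\<theta>'\<in>?S. of_real (a \<theta> * a \<theta>') * (\<theta> x * \<theta>' (inv x)))"
    unfolding char_pairing_def
  proof (rule sum.cong)
    fix x assume "x \<in> X"
    then have "x \<in> carrier G" "inv x \<in> carrier G" using Xc by auto
    then show "\<phi> x * \<phi> (inv x) = (\<Sum>\<theta>\<in>?S. \<Sum>\<theta>'\<in>?S. of_real (a \<theta> * a \<theta>') * (\<theta> x * \<theta>' (inv x)))"
      by (simp add: \<phi> sum_product mult_ac)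
  qed simp
  also have "\<dots> = (\<Sum>\<theta>\<in>?S. \<Sum>x\<in>X. \<Sum>\<theta>'\<in>?S. of_real (a \<theta> * a \<theta>') * (\<theta> x * \<theta>' (inv x)))"
    by (rule sum.swap)
  also have "\<dots> = (\<Sum>\<theta>\<in>?S. \<Sum>\<theta>'\<in>?S. of_real (a \<theta> * a \<theta>') * char_pairing X \<theta> \<theta>')"
    by (rule sum.cong[OF refl], subst sum.swap) (simp add: char_pairing_def sum_distrib_left)
  also have "\<dots> = of_real (\<Sum>\<theta>\<in>?S. \<Sum>\<theta>'\<in>?S. a \<theta> * a \<theta>' * r \<theta> \<theta>')"
    by (simp add: r(1))
  finally have "char_pairing X \<phi> \<phi> = of_real (\<Sum>\<theta>\<in>?S. \<Sum>\<theta>'\<in>?S. a \<theta> * a \<theta>' * r \<theta> \<theta>')" .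
  moreover have "char_pairing X \<phi> \<phi> = of_real (D\<^sup>2 * (\<Sum>x\<in>X. v x))"
    by (simp add: char_pairing_def v D mult.commute sum_distrib_right)
  ultimately have total: "D\<^sup>2 * (\<Sum>x\<in>X. v x) = (\<Sum>\<theta>\<in>?S. \<Sum>\<theta>'\<in>?S. a \<theta> * a \<theta>' * r \<theta> \<theta>')"
    by (simp only: of_real_eq_iff)
  \<comment> \<open>Cauchy-Schwarz for the terms \<open>a \<theta> * d \<theta>\<close>, one for
    each distinct constituent; here the number of constituents enters.\<close>
  have "D\<^sup>2 * W \<le> (\<Sum>\<theta>\<in>?S. (a \<theta> * d \<theta>)\<^sup>2) * real (card ?S) * W"
    using W unfolding D_def by (intro mult_right_mono sum_squared_le_sum_of_squares) auto
  also have "\<dots> = real (card ?S) * (\<Sum>\<theta>\<in>?S. a \<theta> * a \<theta> * r \<theta> \<theta>)"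
    by (simp add: rd sum_distrib_right sum_distrib_left power2_eq_square mult_ac)
  also have "\<dots> \<le> real (card ?S) * (\<Sum>\<theta>\<in>?S. \<Sum>\<theta>'\<in>?S. a \<theta> * a \<theta>' * r \<theta> \<theta>')"
    using r(2) by (intro mult_left_mono sum_mono member_le_sum) (auto simp: a_def)
  also have "\<dots> = D\<^sup>2 * (real (card ?S) * (\<Sum>x\<in>X. v x))" by (simp add: total[symmetric])
  finally have "D\<^sup>2 * W \<le> D\<^sup>2 * (real (card ?S) * (\<Sum>x\<in>X. v x))" .
  moreover have "D\<^sup>2 > 0" using nz D by simp
  ultimately show ?thesis by (simp add: W_def)
qed

end

section \<open>Centres modulo normal subgroups\<close>

lemma (in group) conjugate_pow:
  assumes "g \<in> carrier G" "x \<in> carrier G"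
  shows "g \<otimes> x [^] (n :: nat) \<otimes> inv g = (g \<otimes> x \<otimes> inv g) [^] n"
proof (induction n)
  case (Suc n)
  have "inv g \<otimes> (g \<otimes> x) = x" using assms by (simp flip: m_assoc)
  then have "(g \<otimes> x [^] n \<otimes> inv g) \<otimes> (g \<otimes> x \<otimes> inv g) = g \<otimes> x [^] Suc n \<otimes> inv g"
    using assms by (simp add: m_assoc) (simp flip: m_assoc)
  then show ?case using Suc by simp
qed (use assms in simp)

context fin_group
begin

section \<open>Conjugacy classes and the centre of a p-group\<close>

lemma conj_class_subset: "x \<in> carrier G \<Longrightarrow> conj_class x \<subseteq> carrier G"
  by (auto simp: conj_class_def)

lemma self_in_conj_class: "x \<in> carrier G \<Longrightarrow> x \<in> conj_class x"
  by (auto simp: conj_class_def intro!: image_eqI[of _ _ \<one>])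

lemma finite_conj_class: "finite (conj_class x)"
  by (simp add: conj_class_def finite_carrier)

lemma conj_class_conjugate:
  assumes "x \<in> carrier G" "u \<in> conj_class x" "g \<in> carrier G"
  shows "g \<otimes> u \<otimes> inv g \<in> conj_class x"
proof -
  obtain h where h: "h \<in> carrier G" "u = h \<otimes> x \<otimes> inv h" using assms(2) by (auto simp: conj_class_def)
  then have "g \<otimes> u \<otimes> inv g = (g \<otimes> h) \<otimes> x \<otimes> inv (g \<otimes> h)"
    using assms by (simp add: inv_mult_group m_assoc)
  then show ?thesis using h assms by (auto simp: conj_class_def)
qed

text \<open>A conjugacy class is an orbit of the conjugation action, so the orbit-stabilizer theorem
  applies.\<close>

lemma card_conj_class_dvd:
  assumes x: "x \<in> carrier G"
  shows "card (conj_class x) dvd Coset.order G"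
proof -
  interpret A: group_action G "carrier G" "\<lambda>g. \<lambda>h\<in>carrier G. g \<otimes> h \<otimes> inv g"
    by (rule action_by_conjugation)
  have orb: "orbit G (\<lambda>g. \<lambda>h\<in>carrier G. g \<otimes> h \<otimes> inv g) x = conj_class x"
    using x by (auto simp: orbit_def conj_class_def)
  show ?thesis using A.orbit_stabilizer_theorem[OF x, symmetric] unfolding orb by (rule dvdI)
qed

text \<open>The class size divides a power of \<open>p\<close> and is at least 2.\<close>

lemma prime_dvd_card_conj_class:
  assumes p: "prime p" and ord: "Coset.order G = p ^ k"
    and x: "x \<in> carrier G" and g: "g \<in> carrier G" "g \<otimes> x \<otimes> inv g \<noteq> x"
  shows "p dvd card (conj_class x)"
proof -
  have "card {x, g \<otimes> x \<otimes> inv g} \<le> card (conj_class x)"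
    using self_in_conj_class[OF x] g(1) by (intro card_mono finite_conj_class) (auto simp: conj_class_def)
  moreover have "card {x, g \<otimes> x \<otimes> inv g} = 2" using g(2) by (metis card_2_iff)
  ultimately have "card (conj_class x) \<noteq> 1" by linarith
  moreover have "card (conj_class x) dvd p ^ k" using card_conj_class_dvd[OF x] ord by simp
  ultimately show ?thesis using p by (metis divides_primepow_nat power_0 dvd_power gr0I)
qed

text \<open>The class equation: if only the identity were central, every other class would have size
  divisible by \<open>p\<close>, and then so would the class of the identity.\<close>

lemma nontrivial_centre:
  assumes p: "prime p" and ord: "Coset.order G = p ^ k" "k > 0"
  obtains z where "z \<in> carrier G" "z \<noteq> \<one>" "\<And>g. g \<in> carrier G \<Longrightarrow> g \<otimes> z \<otimes> inv g = z"
proof (rule ccontr)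
  note witness = that
  assume "\<not> thesis"
  then have nc: "\<exists>g\<in>carrier G. g \<otimes> z \<otimes> inv g \<noteq> z" if "z \<in> carrier G" "z \<noteq> \<one>" for z
    using witness[OF that] by blast
  let ?\<phi> = "\<lambda>g. \<lambda>h\<in>carrier G. g \<otimes> h \<otimes> inv g"
  interpret A: group_action G "carrier G" ?\<phi> by (rule action_by_conjugation)
  have orb: "orbit G ?\<phi> x = conj_class x" if "x \<in> carrier G" for x
    using that by (auto simp: orbit_def conj_class_def)
  have orbs: "orbits G (carrier G) ?\<phi> = conj_class ` carrier G"
    using orb by (auto simp: orbits_def)
  have "p dvd card C" if C: "C \<in> conj_class ` carrier G - {{\<one>}}" for C
  proof -
    obtain x where x: "x \<in> carrier G" "C = conj_class x" using C by auto
    have "conj_class \<one> = {\<one>}" by (auto simp: conj_class_def)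
    then have "x \<noteq> \<one>" using C x by auto
    then obtain g where g: "g \<in> carrier G" "g \<otimes> x \<otimes> inv g \<noteq> x" using nc x by blast
    then show ?thesis using prime_dvd_card_conj_class[OF p ord(1) x(1)] x(2) by blast
  qed
  then have "p dvd (\<Sum>C\<in>conj_class ` carrier G - {{\<one>}}. card C)" by (rule dvd_sum)
  moreover have "(\<Sum>C\<in>conj_class ` carrier G. card C) = card (carrier G)"
    using A.disjoint_sum[OF finite_carrier, of "\<lambda>_. 1 :: nat"] unfolding orbs by simp
  moreover have "{\<one>} \<in> conj_class ` carrier G"
    by (rule image_eqI[of _ _ \<one>]) (auto simp: conj_class_def)
  then have "(\<Sum>C\<in>conj_class ` carrier G. card C)
      = card {\<one>} + (\<Sum>C\<in>conj_class ` carrier G - {{\<one>}}. card C)"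
    using finite_carrier by (intro sum.remove) auto
  moreover have "p dvd card (carrier G)" using ord by (simp add: Coset.order_def dvd_power)
  ultimately have "p dvd card {\<one>}" by (metis dvd_add_left_iff)
  then have "p dvd 1" by simp
  then show False using p by (metis not_prime_unit)
qed

text \<open>For normal \<open>N\<close> this is the preimage in \<open>G\<close> of the centre of
  \<open>G Mod N\<close>, expressed by commutators so that computations stay inside
  \<open>G\<close>.\<close>

definition centre_mod :: "'a set \<Rightarrow> 'a set" where
  "centre_mod N = {x \<in> carrier G. \<forall>g\<in>carrier G. g \<otimes> x \<otimes> inv g \<otimes> inv x \<in> N}"

abbreviation centre :: "'a set" where
  "centre \<equiv> centre_mod {\<one>}"

lemma commutator_mult_eq:
  assumes "g \<in> carrier G" "x \<in> carrier G"
  shows "g \<otimes> x \<otimes> inv g \<otimes> inv x \<otimes> x = g \<otimes> x \<otimes> inv g"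
  using assms by (simp add: m_assoc)

lemma mult_inv_eq_one_iff:
  "a \<in> carrier G \<Longrightarrow> b \<in> carrier G \<Longrightarrow> a \<otimes> inv b = \<one> \<longleftrightarrow> a = b"
  by (metis inv_closed inv_equality inv_inv r_inv)

lemma mem_centre: "x \<in> centre \<longleftrightarrow> x \<in> carrier G \<and> (\<forall>g\<in>carrier G. g \<otimes> x \<otimes> inv g = x)"
  by (auto simp: centre_mod_def mult_inv_eq_one_iff)

lemma mem_centre_commute: "x \<in> centre \<Longrightarrow> g \<in> carrier G \<Longrightarrow> g \<otimes> x = x \<otimes> g"
  unfolding mem_centre by (metis inv_solve_right m_closed)

lemma centre_mod_subset: "centre_mod N \<subseteq> carrier G"
  by (auto simp: centre_mod_def)

lemma conjugate_mult:
  assumes "g \<in> carrier G" "x \<in> carrier G" "y \<in> carrier G"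
  shows "g \<otimes> (x \<otimes> y) \<otimes> inv g = (g \<otimes> x \<otimes> inv g) \<otimes> (g \<otimes> y \<otimes> inv g)"
proof -
  have "inv g \<otimes> (g \<otimes> (y \<otimes> inv g)) = y \<otimes> inv g" using assms by (simp flip: m_assoc)
  then show ?thesis using assms by (simp add: m_assoc)
qed

lemma centre_mod_normal:
  assumes N: "N \<lhd> G"
  shows "centre_mod N \<lhd> G"
proof -
  interpret N: normal N G by (rule N)
  have Nc: "N \<subseteq> carrier G" by (rule N.subset)
  have conjN: "g \<otimes> n \<otimes> inv g \<in> N" if "g \<in> carrier G" "n \<in> N" for g n
    using N.inv_op_closed2 that by blast
  show ?thesis
  proof (rule normal_invI)
    show "subgroup (centre_mod N) G"
    proof (rule subgroupI[OF centre_mod_subset])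
      show "centre_mod N \<noteq> {}" using N.one_closed by (auto simp: centre_mod_def intro!: exI[of _ \<one>])
    next
      fix x assume x: "x \<in> centre_mod N"
      then have xc: "x \<in> carrier G" by (simp add: centre_mod_def)
      have "g \<otimes> inv x \<otimes> inv g \<otimes> inv (inv x) \<in> N" if g: "g \<in> carrier G" for g
      proof -
        define n where "n = g \<otimes> x \<otimes> inv g \<otimes> inv x"
        have n: "n \<in> N" using x g by (simp add: centre_mod_def n_def)
        have "g \<otimes> inv x \<otimes> inv g = inv (n \<otimes> x)"
          unfolding n_def commutator_mult_eq[OF g xc] using g xc by (simp add: inv_mult_group m_assoc)
        also have "\<dots> \<otimes> inv (inv x) = inv x \<otimes> inv n \<otimes> inv (inv x)"
          using n Nc xc by (auto simp: inv_mult_group)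
        also have "\<dots> \<in> N" using conjN[of "inv x" "inv n"] xc n by simp
        finally show ?thesis .
      qed
      then show "inv x \<in> centre_mod N" using xc by (simp add: centre_mod_def)
    next
      fix x y assume x: "x \<in> centre_mod N" and y: "y \<in> centre_mod N"
      then have c: "x \<in> carrier G" "y \<in> carrier G" by (simp_all add: centre_mod_def)
      have "g \<otimes> (x \<otimes> y) \<otimes> inv g \<otimes> inv (x \<otimes> y) \<in> N" if g: "g \<in> carrier G" for g
      proof -
        define n m where "n = g \<otimes> x \<otimes> inv g \<otimes> inv x" and "m = g \<otimes> y \<otimes> inv g \<otimes> inv y"
        have nm: "n \<in> N" "m \<in> N" using x y g by (auto simp: centre_mod_def n_def m_def)
        have nmc: "n \<in> carrier G" "m \<in> carrier G" using nm Nc by auto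
        have "g \<otimes> (x \<otimes> y) \<otimes> inv g = (n \<otimes> x) \<otimes> (m \<otimes> y)"
          unfolding conjugate_mult[OF g c] n_def m_def commutator_mult_eq[OF g c(1)] commutator_mult_eq[OF g c(2)] ..
        also have "\<dots> \<otimes> inv (x \<otimes> y) = n \<otimes> (x \<otimes> m \<otimes> inv x)"
          using nmc c by (simp add: inv_mult_group m_assoc) (simp flip: m_assoc)
        also have "\<dots> \<in> N" using conjN[OF c(1) nm(2)] nm by simp
        finally show ?thesis .
      qed
      then show "x \<otimes> y \<in> centre_mod N" using c by (simp add: centre_mod_def)
    qed
  next
      fix h x assume h: "h \<in> carrier G" and x: "x \<in> centre_mod N"
      then have xc: "x \<in> carrier G" by (simp add: centre_mod_def)
      have "g \<otimes> (h \<otimes> x \<otimes> inv h) \<otimes> inv g \<otimes> inv (h \<otimes> x \<otimes> inv h) \<in> N" if g: "g \<in> carrier G" for g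
      proof -
        \<comment> \<open>The commutator of \<open>g\<close> with a conjugate of \<open>x\<close> by
          \<open>h\<close> is the conjugate by \<open>h\<close> of the commutator of this
          \<open>k\<close> with \<open>x\<close>.\<close>
        define k where "k = inv h \<otimes> g \<otimes> h"
        have k: "k \<in> carrier G" "g = h \<otimes> k \<otimes> inv h"
          using g h by (simp_all add: k_def m_assoc) (simp_all flip: m_assoc)
        have "g \<otimes> (h \<otimes> x \<otimes> inv h) \<otimes> inv g \<otimes> inv (h \<otimes> x \<otimes> inv h)
            = h \<otimes> (k \<otimes> x \<otimes> inv k \<otimes> inv x) \<otimes> inv h"
        proof -
          have c: "inv h \<otimes> (h \<otimes> y) = y" if "y \<in> carrier G" for y using that h by (simp flip: m_assoc)
          show ?thesis using h k(1) xc unfolding k(2) by (simp add: inv_mult_group m_assoc c)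
        qed
        then show ?thesis using conjN[OF h] x k(1) by (simp add: centre_mod_def)
      qed
      then show "h \<otimes> x \<otimes> inv h \<in> centre_mod N" using h xc by (simp add: centre_mod_def)
  qed
qed

lemma centre_normal: "centre \<lhd> G"
  by (rule centre_mod_normal[OF one_is_normal])

lemma subset_centre_mod:
  assumes N: "N \<lhd> G"
  shows "N \<subseteq> centre_mod N"
proof
  interpret N: normal N G by (rule N)
  fix x assume x: "x \<in> N"
  then show "x \<in> centre_mod N" using N.inv_op_closed2 N.subset by (auto simp: centre_mod_def)
qed

lemma centre_subset_centre_mod: "\<one> \<in> N \<Longrightarrow> centre \<subseteq> centre_mod N"
  by (auto simp: centre_mod_def)

text \<open>\<open>G Mod N\<close> is a nontrivial group of \<open>p\<close>-power order and so has
  a nontrivial central coset; a representative of it serves as \<open>x\<close>.\<close>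

lemma centre_mod_grows:
  assumes p: "prime p" and ord: "Coset.order G = p ^ k" and N: "N \<lhd> G" and ne: "N \<noteq> carrier G"
  obtains x where "x \<in> centre_mod N" "x \<notin> N"
proof -
  interpret N: normal N G by (rule N)
  interpret Q: fin_group "G Mod N"
    using N.factorgroup_is_group finite_carrier
    by (auto simp: fin_group_def fin_group_axioms_def FactGroup_def RCOSETS_def)
  have lag: "Coset.order (G Mod N) * card N = p ^ k"
    using lagrange[OF N.subgroup_axioms] ord by (simp add: Coset.order_def FactGroup_def)
  then obtain j where j: "Coset.order (G Mod N) = p ^ j"
    using p divides_primepow_nat by (metis dvd_triv_left)
  have "j \<noteq> 0"
  proof
    assume "j = 0"
    then have "card N = card (carrier G)" using lag j ord by (simp add: Coset.order_def)
    then show False using ne card_subset_eq[OF finite_carrier N.subset] by simp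
  qed
  then obtain C where C: "C \<in> carrier (G Mod N)" "C \<noteq> \<one>\<^bsub>G Mod N\<^esub>"
    "\<And>D. D \<in> carrier (G Mod N) \<Longrightarrow> D \<otimes>\<^bsub>G Mod N\<^esub> C \<otimes>\<^bsub>G Mod N\<^esub> inv\<^bsub>G Mod N\<^esub> D = C"
    using Q.nontrivial_centre[OF p j] by blast
  then obtain x where x: "x \<in> carrier G" "C = N #> x" by (auto simp: FactGroup_def RCOSETS_def)
  have "x \<notin> N" using C(2) x coset_join2[OF x(1) N.subgroup_axioms] by (auto simp: FactGroup_def)
  moreover have "g \<otimes> x \<otimes> inv g \<otimes> inv x \<in> N" if g: "g \<in> carrier G" for g
  proof -
    have D: "N #> g \<in> carrier (G Mod N)" using g by (auto simp: FactGroup_def RCOSETS_def)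
    have "(N #> g) \<otimes>\<^bsub>G Mod N\<^esub> C = C \<otimes>\<^bsub>G Mod N\<^esub> (N #> g)"
      using C(3)[OF D] C(1) D by (metis Q.inv_solve_right Q.m_closed)
    then have "N #> (g \<otimes> x) = N #> (x \<otimes> g)"
      using g x by (simp add: FactGroup_def N.rcos_sum)
    then have "g \<otimes> x \<in> N #> (x \<otimes> g)"
      using rcos_self[OF _ N.subgroup_axioms, of "g \<otimes> x"] g x by simp
    then have "g \<otimes> x \<otimes> inv (x \<otimes> g) \<in> N"
      using N.rcos_module[OF is_group, of "x \<otimes> g" "g \<otimes> x"] g x by simp
    then show ?thesis using g x by (simp add: inv_mult_group m_assoc)
  qed
  ultimately show ?thesis using that[of x] x by (simp add: centre_mod_def)
qed

end

section \<open>Good elements\<close>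

lemma (in group) subgroup_nat_pow_closed:
  assumes "subgroup H G" "h \<in> H"
  shows "h [^] (n :: nat) \<in> H"
  using assms by (induction n) (auto simp: subgroup.one_closed subgroup.m_closed)

context fin_group
begin

text \<open>\<open>\<theta>\<close> is constant on the class, so the class-sum formula at
  \<open>y = inv x\<close> isolates \<open>\<theta> x * \<theta> (inv x)\<close>, the quantity
  needed for bounding the number of constituents.\<close>

lemma conj_class_sum:
  assumes \<theta>: "\<theta> \<in> Irr G" and x: "x \<in> carrier G"
  shows "\<theta> \<one> * (\<Sum>u\<in>conj_class x. \<theta> (u \<otimes> inv x)) = of_nat (card (conj_class x)) * (\<theta> x * \<theta> (inv x))"
proof -
  have "\<theta> u = \<theta> x" if "u \<in> conj_class x" for u
    using that Irr_conjugate[OF \<theta> _ x] by (auto simp: conj_class_def)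
  then have "(\<Sum>u\<in>conj_class x. 1 * \<theta> u) = of_nat (card (conj_class x)) * \<theta> x" by simp
  moreover have "\<theta> \<one> * (\<Sum>u\<in>conj_class x. 1 * \<theta> (u \<otimes> inv x)) = (\<Sum>u\<in>conj_class x. 1 * \<theta> u) * \<theta> (inv x)"
    by (rule Irr_class_sum[OF \<theta> conj_class_subset[OF x] inv_closed[OF x] conj_class_conjugate[OF x]]) auto
  ultimately show ?thesis by (simp add: mult.assoc)
qed

text \<open>The class-sum formula for the singleton \<open>{z}\<close>. It makes
  \<open>\<theta> z / \<theta> \<one>\<close> multiplicative in \<open>z\<close>: this is the
  central character of \<open>\<theta>\<close>.\<close>

lemma Irr_central_mult:
  assumes \<theta>: "\<theta> \<in> Irr G" and z: "z \<in> centre" and y: "y \<in> carrier G"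
  shows "\<theta> \<one> * \<theta> (z \<otimes> y) = \<theta> z * \<theta> y"
  using Irr_class_sum[of \<theta> "{z}" y "\<lambda>_. 1"] assms by (auto simp: mem_centre)

lemma centre_inv: "z \<in> centre \<Longrightarrow> inv z \<in> centre"
  using centre_normal by (simp add: normal_def subgroup.m_inv_closed)

lemma Irr_central_inv:
  assumes "\<theta> \<in> Irr G" "z \<in> centre"
  shows "\<theta> z * \<theta> (inv z) = (\<theta> \<one>)\<^sup>2"
  using Irr_central_mult[OF assms, of "inv z"] assms by (simp add: mem_centre power2_eq_square)

text \<open>Conjugation by \<open>g\<close> leaves \<open>\<theta> x\<close> unchanged, yet
  multiplies \<open>x\<close> by a central commutator and hence \<open>\<theta> x\<close> by a
  factor other than 1.\<close>

lemma Irr_vanish: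
  assumes \<theta>: "\<theta> \<in> Irr G" and x: "x \<in> carrier G" and g: "g \<in> carrier G"
    and z: "g \<otimes> x \<otimes> inv g \<otimes> inv x \<in> centre" "\<theta> (g \<otimes> x \<otimes> inv g \<otimes> inv x) \<noteq> \<theta> \<one>"
  shows "\<theta> x = 0"
proof -
  have "\<theta> \<one> * \<theta> x = \<theta> (g \<otimes> x \<otimes> inv g \<otimes> inv x) * \<theta> x"
    using Irr_central_mult[OF \<theta> z(1) x] commutator_mult_eq[OF g x] Irr_conjugate[OF \<theta> g x] by simp
  then show ?thesis using z(2) by simp
qed

text \<open>On the good elements alone can an irreducible character that is faithful on the centre be
  nonzero.\<close>

definition good :: "'a \<Rightarrow> bool" where
  "good x \<longleftrightarrow> (\<forall>g\<in>carrier G. g \<otimes> x \<otimes> inv g \<otimes> inv x \<in> centre \<longrightarrow> g \<otimes> x \<otimes> inv g = x)"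

text \<open>For irreducible \<open>\<theta>\<close> this is injectivity of the central character. It
  can be established for all constituents of a product at once, as they share that
  character.\<close>

definition faithful_on_centre :: "('a \<Rightarrow> complex) \<Rightarrow> bool" where
  "faithful_on_centre \<theta> \<longleftrightarrow> (\<forall>z\<in>centre. \<theta> z = \<theta> \<one> \<longrightarrow> z = \<one>)"

lemma faithful_char_on_centre: "faithful_char G \<chi> \<Longrightarrow> faithful_on_centre \<chi>"
  by (auto simp: faithful_char_def char_kernel_def faithful_on_centre_def centre_mod_def)

lemma central_good: "x \<in> centre \<Longrightarrow> good x"
  by (auto simp: good_def mem_centre)

text \<open>Failure of goodness supplies a nontrivial central commutator, which faithfulness on the
  centre detects.\<close>

lemma not_good_vanish:
  assumes "\<theta> \<in> Irr G" "faithful_on_centre \<theta>" "x \<in> carrier G" "\<not> good x"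
  shows "\<theta> x = 0"
proof -
  obtain g where g: "g \<in> carrier G" "g \<otimes> x \<otimes> inv g \<otimes> inv x \<in> centre" "g \<otimes> x \<otimes> inv g \<noteq> x"
    using assms(4) by (auto simp: good_def)
  have "g \<otimes> x \<otimes> inv g \<otimes> inv x \<noteq> \<one>" using g assms(3) by (simp add: mult_inv_eq_one_iff)
  then have "\<theta> (g \<otimes> x \<otimes> inv g \<otimes> inv x) \<noteq> \<theta> \<one>"
    using assms(2) g(2) by (auto simp: faithful_on_centre_def)
  then show ?thesis using Irr_vanish[OF assms(1,3) g(1,2)] by simp
qed

text \<open>Under the hypotheses of \<open>Irr_weight\<close>, the value of
  \<open>\<theta> x * \<theta> (inv x)\<close> relative to the squared degree; it is the same for
  every such \<open>\<theta>\<close>.\<close>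

definition weight :: "'a \<Rightarrow> real" where
  "weight x = (if good x then 1 / real (card (conj_class x)) else 0)"

lemma card_conj_class_pos: "x \<in> carrier G \<Longrightarrow> card (conj_class x) > 0"
  using self_in_conj_class[of x] finite_conj_class by (auto simp: card_gt_0_iff)

lemma weight_nonneg: "weight x \<ge> 0"
  by (simp add: weight_def)

text \<open>For good \<open>x\<close>, each \<open>u\<close> other than \<open>x\<close> in its
  class gives a noncentral commutator \<open>u \<otimes> inv x\<close> in \<open>N\<close>. That
  element is not good, so \<open>\<theta>\<close> vanishes there and the class sum at
  \<open>inv x\<close> reduces to the term \<open>u = x\<close>.\<close>

lemma Irr_weight:
  assumes N: "N \<lhd> G" and good_central: "\<And>x. x \<in> N \<Longrightarrow> good x \<Longrightarrow> x \<in> centre"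
    and \<theta>: "\<theta> \<in> Irr G" "faithful_on_centre \<theta>" and x: "x \<in> centre_mod N"
  shows "\<theta> x * \<theta> (inv x) = of_real (weight x) * (\<theta> \<one>)\<^sup>2"
proof (cases "good x")
  case False
  then show ?thesis using not_good_vanish[OF \<theta>, of x] x by (simp add: weight_def centre_mod_def)
next
  case True
  interpret N: normal N G by (rule N)
  have xc: "x \<in> carrier G" using x by (simp add: centre_mod_def)
  have "\<theta> (u \<otimes> inv x) = 0" if u: "u \<in> conj_class x - {x}" for u
  proof -
    obtain g where g: "g \<in> carrier G" "u = g \<otimes> x \<otimes> inv g" using u by (auto simp: conj_class_def)
    have uN: "u \<otimes> inv x \<in> N" using x g by (simp add: centre_mod_def)
    have "u \<otimes> inv x \<notin> centre" using True g u by (auto simp: good_def)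
    then have "\<not> good (u \<otimes> inv x)" using good_central[OF uN] by auto
    then show ?thesis using not_good_vanish[OF \<theta>] uN N.subset by auto
  qed
  then have "(\<Sum>u\<in>conj_class x. \<theta> (u \<otimes> inv x)) = (\<Sum>u\<in>{x}. \<theta> (u \<otimes> inv x))"
    using self_in_conj_class[OF xc] finite_conj_class by (intro sum.mono_neutral_right) auto
  then have "\<theta> \<one> * \<theta> \<one> = of_nat (card (conj_class x)) * (\<theta> x * \<theta> (inv x))"
    using conj_class_sum[OF \<theta>(1) xc] xc by simp
  then show ?thesis using True self_in_conj_class[OF xc] finite_conj_class[of x]
    by (auto simp: weight_def power2_eq_square field_simps)
qed

section \<open>Weights of cosets and powers of good elements\<close>

lemma mem_coset_iff:
  assumes "N \<lhd> G" "x \<in> carrier G"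
  shows "u \<in> N #> x \<longleftrightarrow> u \<in> carrier G \<and> u \<otimes> inv x \<in> N"
proof -
  interpret N: normal N G by fact
  show ?thesis using N.rcos_module[OF is_group, of x u] N.elemrcos_carrier[OF is_group, of x u] assms by auto
qed

text \<open>Modulo \<open>N\<close> the element \<open>x\<close> is central. The coset is therefore
  a union of conjugacy classes, as the class-sum formula requires.\<close>

lemma coset_conjugate:
  assumes N: "N \<lhd> G" and x: "x \<in> centre_mod N" and u: "u \<in> N #> x" and g: "g \<in> carrier G"
  shows "g \<otimes> u \<otimes> inv g \<in> N #> x"
proof -
  interpret N: normal N G by (rule N)
  have xc: "x \<in> carrier G" using x by (simp add: centre_mod_def)
  obtain n where n: "n \<in> N" "u = n \<otimes> x" using u by (auto simp: r_coset_def)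
  have nc: "n \<in> carrier G" using n N.subset by auto
  have "g \<otimes> u \<otimes> inv g \<otimes> inv x = (g \<otimes> n \<otimes> inv g) \<otimes> (g \<otimes> x \<otimes> inv g \<otimes> inv x)"
    unfolding n conjugate_mult[OF g nc xc] using g nc xc by (simp add: m_assoc)
  also have "\<dots> \<in> N"
    using N.inv_op_closed2[OF g n(1)] x g by (simp add: centre_mod_def)
  finally show ?thesis using mem_coset_iff[OF N xc] g nc xc n by simp
qed

lemma coset_subset_centre_mod:
  assumes N: "N \<lhd> G" and x: "x \<in> centre_mod N"
  shows "N #> x \<subseteq> centre_mod N"
proof
  interpret C: normal "centre_mod N" G by (rule centre_mod_normal[OF N])
  fix u assume "u \<in> N #> x"
  then obtain n where "n \<in> N" "u = n \<otimes> x" by (auto simp: r_coset_def)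
  then show "u \<in> centre_mod N" using subset_centre_mod[OF N] x by auto
qed

text \<open>Convolving \<open>\<theta>\<close> with the restriction of its dual to the coset gives a multiple of \<open>\<theta>\<close>; at
  the inverse of \<open>x\<close> only the central elements contribute, since \<open>\<theta>\<close> vanishes on the rest of \<open>N\<close>.\<close>

lemma sum_weight_coset:
  assumes N: "N \<lhd> G" "centre \<subseteq> N" and good_central: "\<And>x. x \<in> N \<Longrightarrow> good x \<Longrightarrow> x \<in> centre"
    and \<theta>: "\<theta> \<in> Irr G" "faithful_on_centre \<theta>" and x: "x \<in> centre_mod N" "good x"
  shows "(\<Sum>u\<in>N #> x. weight u) = real (card centre)"
proof -
  interpret N: normal N G by (rule N)
  have xc: "x \<in> carrier G" using x by (simp add: centre_mod_def)
  have sub: "N #> x \<subseteq> carrier G" using mem_coset_iff[OF N(1) xc] by auto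
  have \<theta>w: "\<theta> u * \<theta> (inv u) = of_real (weight u) * (\<theta> \<one>)\<^sup>2" if "u \<in> centre_mod N" for u
    using Irr_weight[OF N(1) good_central \<theta> that] by blast
  \<comment> \<open>A good \<open>x\<close> has nonzero weight; the resulting nonzero value is
    cancelled at the end.\<close>
  have nz: "\<theta> (inv x) \<noteq> 0"
    using \<theta>w[OF x(1)] Irr_degree_nonzero[OF \<theta>(1)] card_conj_class_pos[OF xc] x(2)
    by (auto simp: weight_def)
  have dual: "\<theta> (inv (g \<otimes> u \<otimes> inv g)) = \<theta> (inv u)" if "g \<in> carrier G" "u \<in> N #> x" for g u
  proof -
    have u: "u \<in> carrier G" using that sub by auto
    have "inv (g \<otimes> u \<otimes> inv g) = g \<otimes> inv u \<otimes> inv g" using that(1) u by (simp add: inv_mult_group m_assoc)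
    then show ?thesis using Irr_conjugate[OF \<theta>(1) that(1), of "inv u"] u by simp
  qed
  have "\<theta> \<one> * (\<Sum>u\<in>N #> x. \<theta> (inv u) * \<theta> (u \<otimes> inv x)) = (\<Sum>u\<in>N #> x. \<theta> (inv u) * \<theta> u) * \<theta> (inv x)"
    by (rule Irr_class_sum[where F = "\<lambda>u. \<theta> (inv u)", OF \<theta>(1) sub inv_closed[OF xc]])
      (use coset_conjugate[OF N(1) x(1)] dual in auto)
  also have "(\<Sum>u\<in>N #> x. \<theta> (inv u) * \<theta> u) = (\<Sum>u\<in>N #> x. of_real (weight u) * (\<theta> \<one>)\<^sup>2)"
    using \<theta>w coset_subset_centre_mod[OF N(1) x(1)] by (intro sum.cong) (auto simp: mult.commute)
  also have "(\<Sum>u\<in>N #> x. \<theta> (inv u) * \<theta> (u \<otimes> inv x)) = (\<Sum>n\<in>N. \<theta> (inv (n \<otimes> x)) * \<theta> n)"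
  proof (rule sum.reindex_bij_witness[where i = "\<lambda>n. n \<otimes> x" and j = "\<lambda>u. u \<otimes> inv x"])
    fix u assume "u \<in> N #> x"
    then have u: "u \<in> carrier G" "u \<otimes> inv x \<in> N" using mem_coset_iff[OF N(1) xc] by auto
    then show "u \<otimes> inv x \<otimes> x = u" "u \<otimes> inv x \<in> N" using xc by (auto simp: m_assoc)
    then show "\<theta> (inv (u \<otimes> inv x \<otimes> x)) * \<theta> (u \<otimes> inv x) = \<theta> (inv u) * \<theta> (u \<otimes> inv x)" by simp
  next
    fix n assume n: "n \<in> N"
    then have nc: "n \<in> carrier G" using N.subset by auto
    then show "n \<otimes> x \<otimes> inv x = n" using xc by (simp add: m_assoc)
    then show "n \<otimes> x \<in> N #> x" using mem_coset_iff[OF N(1) xc] nc xc n by simp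
  qed
  also have "\<dots> = (\<Sum>n\<in>centre. \<theta> (inv (n \<otimes> x)) * \<theta> n)"
  proof (rule sum.mono_neutral_right)
    show "finite N" using finite_subset[OF N.subset finite_carrier] .
    show "\<forall>n\<in>N - centre. \<theta> (inv (n \<otimes> x)) * \<theta> n = 0"
      using good_central not_good_vanish[OF \<theta>] N.subset by auto
  qed (rule N(2))
  \<comment> \<open>The central character values at \<open>n\<close> and \<open>inv n\<close>
    cancel, so every central \<open>n\<close> contributes the same amount.\<close>
  also have "\<theta> \<one> * \<dots> = (\<Sum>n\<in>centre. (\<theta> \<one>)\<^sup>2 * \<theta> (inv x))"
    unfolding sum_distrib_left
  proof (rule sum.cong)
    fix n assume n: "n \<in> centre"
    then have nc: "n \<in> carrier G" by (simp add: mem_centre)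
    have "inv (n \<otimes> x) = inv n \<otimes> inv x"
      using mem_centre_commute[OF centre_inv[OF n], of "inv x"] nc xc by (simp add: inv_mult_group)
    then have "\<theta> \<one> * (\<theta> (inv (n \<otimes> x)) * \<theta> n) = (\<theta> \<one> * \<theta> (inv n \<otimes> inv x)) * \<theta> n" by simp
    also have "\<dots> = (\<theta> n * \<theta> (inv n)) * \<theta> (inv x)"
      using Irr_central_mult[OF \<theta>(1) centre_inv[OF n], of "inv x"] xc by simp
    finally show "\<theta> \<one> * (\<theta> (inv (n \<otimes> x)) * \<theta> n) = (\<theta> \<one>)\<^sup>2 * \<theta> (inv x)"
      using Irr_central_inv[OF \<theta>(1) n] by simp
  qed simp
  finally have "of_nat (card centre) * ((\<theta> \<one>)\<^sup>2 * \<theta> (inv x))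
      = of_real (\<Sum>u\<in>N #> x. weight u) * ((\<theta> \<one>)\<^sup>2 * \<theta> (inv x))"
    by (simp add: sum_distrib_right mult.assoc)
  then have "complex_of_real (\<Sum>u\<in>N #> x. weight u) = of_real (real (card centre))"
    using nz Irr_degree_nonzero[OF \<theta>(1)] by simp
  then show ?thesis by (simp only: of_real_eq_iff)
qed

text \<open>As \<open>x\<close> is a power of \<open>x [^] i\<close>, a central commutator
  \<open>z\<close> of \<open>x [^] i\<close> turns into the commutator \<open>z [^] k\<close> of
  \<open>x\<close>. Goodness of \<open>x\<close> then makes \<open>g\<close> commute with
  \<open>x\<close>, hence with its power.\<close>

lemma good_pow:
  assumes x: "x \<in> carrier G" "good x" and k: "(x [^] (i :: nat)) [^] (k :: nat) = x"
  shows "good (x [^] i)"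
  unfolding good_def
proof (intro ballI impI)
  fix g assume g: "g \<in> carrier G" and c: "g \<otimes> x [^] i \<otimes> inv g \<otimes> inv (x [^] i) \<in> centre"
  define z where "z = g \<otimes> x [^] i \<otimes> inv g \<otimes> inv (x [^] i)"
  have z: "z \<in> centre" "z \<in> carrier G" using c by (auto simp: z_def mem_centre)
  have zx: "g \<otimes> x [^] i \<otimes> inv g = z \<otimes> x [^] i"
    unfolding z_def using commutator_mult_eq[OF g, of "x [^] i"] x by simp
  have "g \<otimes> x \<otimes> inv g = (z \<otimes> x [^] i) [^] k"
    using conjugate_pow[OF g, of "x [^] i" k] x k zx by simp
  also have "\<dots> = z [^] k \<otimes> x"
    using pow_mult_distrib[of z "x [^] i" k] mem_centre_commute[OF z(1), of "x [^] i"] z x k by simp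
  finally have "g \<otimes> x \<otimes> inv g \<otimes> inv x = z [^] k" using z x by (simp add: m_assoc)
  moreover have "z [^] k \<in> centre"
    using centre_normal z(1) by (simp add: normal_def subgroup_nat_pow_closed)
  ultimately have "g \<otimes> x \<otimes> inv g = x" using x(2) g by (auto simp: good_def)
  then show "g \<otimes> x [^] i \<otimes> inv g = x [^] i" using conjugate_pow[OF g x(1), of i] by simp
qed


text \<open>The sum \<open>S\<close> pairs \<open>\<theta>\<close> with the translate of
  \<open>\<phi>\<close> by \<open>z\<close>. The translation can be pulled out through the central
  character of either factor, and the pairing \<open>P\<close> is nonzero because
  \<open>\<theta>\<close> occurs.\<close>

lemma constituent_on_centre:
  assumes \<chi>: "\<chi> \<in> Irr G" and \<psi>: "\<psi> \<in> Irr G"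
    and M: "irr_decomposition G (\<lambda>g. \<chi> g * \<psi> g) M" and \<theta>: "\<theta> \<in># M" and z: "z \<in> centre"
  shows "\<theta> z * (\<chi> \<one> * \<psi> \<one>) = (\<chi> z * \<psi> z) * \<theta> \<one>"
proof -
  define \<phi> where "\<phi> = (\<lambda>g. \<chi> g * \<psi> g)"
  have \<theta>I: "\<theta> \<in> Irr G" using M \<theta> by (auto simp: irr_decomposition_def)
  have zc: "z \<in> carrier G" using z by (simp add: mem_centre)
  have \<phi>z: "\<phi> \<one> * \<phi> (z \<otimes> y) = \<phi> z * \<phi> y" if y: "y \<in> carrier G" for y
  proof -
    have "\<phi> \<one> * \<phi> (z \<otimes> y) = (\<chi> \<one> * \<chi> (z \<otimes> y)) * (\<psi> \<one> * \<psi> (z \<otimes> y))"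
      by (simp add: \<phi>_def mult_ac)
    also have "\<dots> = \<phi> z * \<phi> y"
      unfolding Irr_central_mult[OF \<chi> z y] Irr_central_mult[OF \<psi> z y] by (simp add: \<phi>_def mult_ac)
    finally show ?thesis .
  qed
  define P where "P = char_pairing (carrier G) \<phi> \<theta>"
  define S where "S = (\<Sum>y\<in>carrier G. \<phi> (z \<otimes> y) * \<theta> (inv y))"
  have "card (carrier G) \<noteq> 0" using finite_carrier one_closed by (auto simp: card_eq_0_iff)
  then have P: "P \<noteq> 0" using irr_decomposition_coefficient[OF M \<theta>I] \<theta> by (simp add: P_def \<phi>_def)
  have "\<phi> \<one> * S = (\<Sum>y\<in>carrier G. (\<phi> \<one> * \<phi> (z \<otimes> y)) * \<theta> (inv y))"
    by (simp add: S_def sum_distrib_left mult.assoc)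
  then have 1: "\<phi> \<one> * S = \<phi> z * P"
    by (simp add: \<phi>z P_def char_pairing_def sum_distrib_left mult.assoc)
  have "S = (\<Sum>y\<in>carrier G. \<phi> y * \<theta> (z \<otimes> inv y))"
    unfolding S_def
  proof (rule sum.reindex_bij_witness[where i = "\<lambda>y. inv z \<otimes> y" and j = "\<lambda>y. z \<otimes> y"])
    fix y assume y: "y \<in> carrier G"
    show "inv z \<otimes> (z \<otimes> y) = y" "z \<otimes> (inv z \<otimes> y) = y" using y zc by (simp_all flip: m_assoc)
    have "z \<otimes> inv (z \<otimes> y) = inv y"
      using mem_centre_commute[OF z, of "inv (z \<otimes> y)"] y zc by (simp add: inv_mult_group m_assoc)
    then show "\<phi> (z \<otimes> y) * \<theta> (z \<otimes> inv (z \<otimes> y)) = \<phi> (z \<otimes> y) * \<theta> (inv y)" by simp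
  qed (use zc in auto)
  then have "\<theta> \<one> * S = (\<Sum>y\<in>carrier G. \<phi> y * (\<theta> \<one> * \<theta> (z \<otimes> inv y)))"
    by (simp add: sum_distrib_left mult_ac)
  then have 2: "\<theta> \<one> * S = \<theta> z * P"
    by (simp add: Irr_central_mult[OF \<theta>I z] P_def char_pairing_def sum_distrib_left mult_ac)
  have "(\<theta> z * \<phi> \<one>) * P = \<phi> \<one> * (\<theta> \<one> * S)" unfolding 2 by (simp only: mult_ac)
  also have "\<dots> = (\<phi> \<one> * S) * \<theta> \<one>" by (simp only: mult_ac)
  also have "\<dots> = (\<phi> z * \<theta> \<one>) * P" unfolding 1 by (simp only: mult_ac)
  finally show ?thesis using P by (simp add: \<phi>_def)
qed

text \<open>Two constituents have the same central character and vanish off the centre, so they are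
  proportional. If distinct they would be orthogonal, against the nonzero norm.\<close>

lemma single_constituent:
  assumes \<chi>: "\<chi> \<in> Irr G" and \<psi>: "\<psi> \<in> Irr G"
    and M: "irr_decomposition G (\<lambda>g. \<chi> g * \<psi> g) M"
    and vanish: "\<And>\<theta> x. \<theta> \<in># M \<Longrightarrow> x \<in> carrier G \<Longrightarrow> x \<notin> centre \<Longrightarrow> \<theta> x = 0"
  shows "card (set_mset M) = 1"
proof -
  have d: "\<chi> \<one> * \<psi> \<one> \<noteq> 0" using \<chi> \<psi> by simp
  have "M \<noteq> {#}"
  proof
    assume "M = {#}"
    then have "\<chi> \<one> * \<psi> \<one> = 0" using M by (auto simp: irr_decomposition_def)
    then show False using d by simp
  qed
  moreover have "\<theta> = \<theta>'" if \<theta>: "\<theta> \<in># M" and \<theta>': "\<theta>' \<in># M" for \<theta> \<theta>'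
  proof (rule ccontr)
    assume ne: "\<theta> \<noteq> \<theta>'"
    have I: "\<theta> \<in> Irr G" "\<theta>' \<in> Irr G" using M \<theta> \<theta>' by (auto simp: irr_decomposition_def)
    have proportional: "\<theta>' x * \<theta> \<one> = \<theta> x * \<theta>' \<one>" if x: "x \<in> carrier G" for x
    proof (cases "x \<in> centre")
      case True
      have "(\<theta>' x * \<theta> \<one>) * (\<chi> \<one> * \<psi> \<one>) = (\<theta>' x * (\<chi> \<one> * \<psi> \<one>)) * \<theta> \<one>" by (simp only: mult_ac)
      also have "\<dots> = (\<theta> x * (\<chi> \<one> * \<psi> \<one>)) * \<theta>' \<one>"
        unfolding constituent_on_centre[OF \<chi> \<psi> M \<theta> True] constituent_on_centre[OF \<chi> \<psi> M \<theta>' True]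
        by (simp only: mult_ac)
      also have "\<dots> = (\<theta> x * \<theta>' \<one>) * (\<chi> \<one> * \<psi> \<one>)" by (simp only: mult_ac)
      finally show ?thesis using d by simp
    next
      case False
      then show ?thesis using vanish[OF \<theta> x] vanish[OF \<theta>' x] by simp
    qed
    have "char_pairing (carrier G) \<theta> \<theta>' * \<theta> \<one> = char_pairing (carrier G) \<theta> \<theta> * \<theta>' \<one>"
      unfolding char_pairing_def sum_distrib_right
      by (intro sum.cong) (simp_all add: mult.assoc proportional)
    then have "of_nat (card (carrier G)) * \<theta>' \<one> = 0"
      by (simp add: Irr_orthogonal[OF I ne] Irr_norm[OF I(1)])
    then show False using I finite_carrier one_closed by (auto simp: card_eq_0_iff)
  qed
  ultimately have "\<exists>\<theta>. set_mset M = {\<theta>}" by (metis multiset_nonemptyE is_singletonI' is_singleton_def set_mset_eq_empty_iff)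
  then show ?thesis by auto
qed

end

section \<open>Counting constituents\<close>

text \<open>The first \<open>p\<close> powers of \<open>\<zeta>\<close> are distinct and so exhaust
  the \<open>p\<close> complex solutions of \<open>z ^ p = 1\<close>.\<close>

lemma prime_root_of_unity_power:
  fixes \<zeta> w :: complex
  assumes p: "prime p" and \<zeta>: "\<zeta> ^ p = 1" "\<zeta> \<noteq> 1" and w: "w ^ p = 1"
  obtains j where "w = \<zeta> ^ j"
proof -
  have p0: "p > 0" using p by (simp add: prime_gt_0_nat)
  have nz: "\<zeta> \<noteq> 0" using \<zeta>(1) p0 by (auto simp: power_0_left)
  have lt: "\<zeta> ^ i \<noteq> 1" if "0 < i" "i < p" for i
  proof
    assume i: "\<zeta> ^ i = 1"
    \<comment> \<open>The exponent \<open>i\<close> is invertible modulo \<open>p\<close>, so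
      \<open>\<zeta> ^ i = 1\<close> would already force \<open>\<zeta> = 1\<close>.\<close>
    have "coprime i p" using p that by (metis coprime_commute nat_dvd_not_less prime_imp_coprime)
    then obtain m where m: "[i * m = 1] (mod p)" using cong_solve_coprime_nat by (metis One_nat_def)
    then obtain q where "i * m = 1 + q * p" using that p prime_gt_1_nat[OF p]
      by (metis cong_def mod_less mult.commute div_mult_mod_eq add.commute)
    then have "\<zeta> ^ (i * m) = \<zeta>" using \<zeta>(1) by (simp add: power_add mult.commute[of q] power_mult)
    then show False using i \<zeta>(2) by (simp add: power_mult)
  qed
  have inj: "inj_on (\<lambda>j. \<zeta> ^ j) {..<p}"
  proof (rule linorder_inj_onI')
    fix i j assume ij: "i \<in> {..<p}" "j \<in> {..<p}" "i < j"
    have "\<zeta> ^ j = \<zeta> ^ i * \<zeta> ^ (j - i)" using ij by (simp flip: power_add)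
    then show "\<zeta> ^ i \<noteq> \<zeta> ^ j" using lt[of "j - i"] ij nz by auto
  qed
  have "(\<lambda>j. \<zeta> ^ j) ` {..<p} = {z. z ^ p = 1}"
  proof (rule card_subset_eq)
    show "finite {z :: complex. z ^ p = 1}" using p0 by (intro finite_roots_unity) auto
    have "(\<zeta> ^ j) ^ p = 1" for j using \<zeta>(1) by (metis mult.commute power_mult power_one)
    then show "(\<lambda>j. \<zeta> ^ j) ` {..<p} \<subseteq> {z. z ^ p = 1}" by auto
    show "card ((\<lambda>j. \<zeta> ^ j) ` {..<p}) = card {z :: complex. z ^ p = 1}"
      using card_roots_unity_eq[of p] p0 inj by (simp add: card_image)
  qed
  then show ?thesis using w that by blast
qed

section \<open>Powers in a p-group, sums of weights and the case distinction\<close>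

context fin_group
begin

lemma pow_eq_one_mod_order:
  assumes x: "x \<in> carrier G" and "[m = 1] (mod Coset.order G)"
  shows "x [^] m = x"
proof -
  obtain a b where "1 + a * Coset.order G = m + b * Coset.order G"
    using assms(2) unfolding cong_iff_lin_nat by blast
  then have "m + Coset.order G * b = 1 + Coset.order G * a" by (simp add: mult.commute)
  then have "x [^] (m + Coset.order G * b) = x [^] (1 + Coset.order G * a)" by simp
  moreover have "x [^] (Coset.order G * n) = \<one>" for n
    using x pow_order_eq_1[OF x] by (simp flip: nat_pow_pow)
  ultimately show ?thesis using x by (simp flip: nat_pow_mult)
qed

text \<open>The inverse of \<open>i\<close> modulo the group order serves as \<open>m\<close>. This
  supplies the hypothesis of \<open>good_pow\<close>.\<close>

lemma pow_pow_eq_self: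
  assumes p: "prime p" and ord: "Coset.order G = p ^ k" and x: "x \<in> carrier G" and i: "0 < i" "i < p"
  obtains m :: nat where "(x [^] (i :: nat)) [^] m = x"
proof -
  have "coprime i p" using p i by (metis coprime_commute nat_dvd_not_less prime_imp_coprime)
  then have "coprime i (p ^ k)" by simp
  then obtain m where "[i * m = 1] (mod p ^ k)" using cong_solve_coprime_nat by (metis One_nat_def)
  then have "x [^] (i * m) = x" using pow_eq_one_mod_order[OF x] ord by simp
  then show ?thesis using that[of m] x by (simp add: nat_pow_pow)
qed

text \<open>Iterated \<open>p\<close>-th powers of \<open>x\<close> reach the identity and so enter
  \<open>H\<close>; the last one before the first entry is taken.\<close>

lemma last_p_power_outside:
  assumes p: "prime p" and ord: "Coset.order G = p ^ k" and H: "subgroup H G"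
    and x: "x \<in> carrier G" "x \<notin> H"
  obtains m where "x [^] (p ^ m) \<notin> H" "(x [^] (p ^ m)) [^] p \<in> H"
proof -
  have "x [^] (p ^ k) \<in> H" using pow_order_eq_1[OF x(1)] ord subgroup.one_closed[OF H] by simp
  then have ex: "\<exists>n. x [^] (p ^ n) \<in> H" by blast
  define n where "n = (LEAST n. x [^] (p ^ n) \<in> H)"
  have n: "x [^] (p ^ n) \<in> H" using LeastI_ex[OF ex] by (simp add: n_def)
  have "n \<noteq> 0" using n x by (intro notI) simp
  then obtain m where m: "n = Suc m" by (cases n) auto
  have "x [^] (p ^ m) \<notin> H" using not_less_Least[of m "\<lambda>n. x [^] (p ^ n) \<in> H"] m by (simp add: n_def)
  moreover have "(x [^] (p ^ m)) [^] p \<in> H" using n x m by (simp add: nat_pow_pow mult.commute)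
  ultimately show ?thesis by (rule that)
qed

lemma weight_central: "x \<in> centre \<Longrightarrow> weight x = 1"
proof -
  assume x: "x \<in> centre"
  then have "conj_class x = {x}" by (auto simp: conj_class_def mem_centre intro!: image_eqI[of _ _ \<one>])
  then show ?thesis using central_good[OF x] by (simp add: weight_def)
qed

text \<open>The class of a noncentral element has a positive multiple of \<open>p\<close>
  elements.\<close>

lemma weight_noncentral_le:
  assumes p: "prime p" and ord: "Coset.order G = p ^ k" and x: "x \<in> carrier G" "x \<notin> centre"
  shows "weight x \<le> 1 / real p"
proof -
  obtain g where g: "g \<in> carrier G" "g \<otimes> x \<otimes> inv g \<noteq> x" using x by (auto simp: mem_centre)
  then have "p dvd card (conj_class x)" by (rule prime_dvd_card_conj_class[OF p ord x(1)])
  then have "p \<le> card (conj_class x)" using card_conj_class_pos[OF x(1)] by (rule dvd_imp_le)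
  then show ?thesis using prime_gt_0_nat[OF p] by (simp add: weight_def frac_le)
qed

text \<open>The cosets of \<open>x [^] i\<close> for \<open>i < p\<close> each have weight
  \<open>card centre\<close>, as these powers are good. If two of them met, a power of
  \<open>x\<close> with positive exponent below \<open>p\<close> would lie in \<open>N\<close>, and
  with it \<open>x\<close>.\<close>

lemma sum_weight_lower_bound:
  assumes p: "prime p" and ord: "Coset.order G = p ^ k"
    and N: "N \<lhd> G" "centre \<subseteq> N" and good_central: "\<And>x. x \<in> N \<Longrightarrow> good x \<Longrightarrow> x \<in> centre"
    and \<theta>: "\<theta> \<in> Irr G" "faithful_on_centre \<theta>" and x: "x \<in> centre_mod N" "good x" "x \<notin> N"
  shows "real p * real (card centre) \<le> (\<Sum>u\<in>centre_mod N. weight u)"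
proof -
  have xc: "x \<in> carrier G" using x centre_mod_subset by auto
  interpret N: normal N G by (rule N(1))
  interpret C: normal "centre_mod N" G by (rule centre_mod_normal[OF N(1)])
  have powN: "x [^] i \<notin> N" if i: "0 < i" "i < p" for i :: nat
  proof
    assume "x [^] i \<in> N"
    moreover obtain m :: nat where "(x [^] i) [^] m = x" using pow_pow_eq_self[OF p ord xc i] .
    ultimately show False using subgroup_nat_pow_closed[OF N.subgroup_axioms, of "x [^] i" m] x(3) by simp
  qed
  have good: "good (x [^] i)" if i: "i < p" for i :: nat
  proof (cases "i = 0")
    case True
    then show ?thesis using central_good[of \<one>] by (simp add: mem_centre)
  next
    case False
    then obtain m :: nat where "(x [^] i) [^] m = x" using pow_pow_eq_self[OF p ord xc _ i] by blast
    then show ?thesis by (rule good_pow[OF xc x(2)])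
  qed
  have mem: "x [^] i \<in> centre_mod N" for i :: nat
    using subgroup_nat_pow_closed[OF C.subgroup_axioms x(1)] .
  have disj_lt: "(N #> x [^] i) \<inter> (N #> x [^] j) = {}" if ij: "i < j" "j < p" for i j :: nat
  proof (rule ccontr)
    assume "(N #> x [^] i) \<inter> (N #> x [^] j) \<noteq> {}"
    then obtain u where u: "u \<in> N #> x [^] i" "u \<in> N #> x [^] j" by auto
    have "N #> x [^] i = N #> x [^] j"
      using repr_independence[OF u(1) _ N.subgroup_axioms] repr_independence[OF u(2) _ N.subgroup_axioms] xc by simp
    then have "x [^] j \<in> N #> x [^] i" using rcos_self[OF _ N.subgroup_axioms, of "x [^] j"] xc by simp
    then have "x [^] j \<otimes> inv (x [^] i) \<in> N" using mem_coset_iff[OF N(1), of "x [^] i"] xc by simp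
    moreover have "x [^] j = x [^] (j - i) \<otimes> x [^] i" using ij xc by (simp add: nat_pow_mult)
    ultimately have "x [^] (j - i) \<in> N" using xc by (simp add: m_assoc)
    then show False using powN[of "j - i"] ij by simp
  qed
  have disj: "(N #> x [^] i) \<inter> (N #> x [^] j) = {}" if "i < p" "j < p" "i \<noteq> j" for i j :: nat
    using disj_lt[of i j] disj_lt[of j i] that by (cases "i < j") auto
  have sub: "N #> x [^] i \<subseteq> centre_mod N" for i :: nat by (rule coset_subset_centre_mod[OF N(1) mem])
  have fin: "finite (centre_mod N)" using finite_subset[OF C.subset finite_carrier] .
  have "real p * real (card centre) = (\<Sum>i<p. \<Sum>u\<in>N #> x [^] i. weight u)"
    using sum_weight_coset[OF N good_central \<theta> mem good] by simp
  also have "\<dots> = (\<Sum>u\<in>(\<Union>i<p. N #> x [^] i). weight u)"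
    using disj finite_subset[OF sub fin] by (intro sum.UNION_disjoint[symmetric]) auto
  also have "\<dots> \<le> (\<Sum>u\<in>centre_mod N. weight u)"
    using sub weight_nonneg by (intro sum_mono2 fin) auto
  finally show ?thesis .
qed

lemma many_constituents_faithful:
  assumes p: "prime p" and ord: "Coset.order G = p ^ k"
    and \<chi>: "\<chi> \<in> Irr G" "faithful_on_centre \<chi>" and \<psi>: "\<psi> \<in> Irr G" "faithful_on_centre \<psi>"
    and M: "irr_decomposition G (\<lambda>g. \<chi> g * \<psi> g) M"
    and faithful: "\<And>\<theta>. \<theta> \<in># M \<Longrightarrow> faithful_on_centre \<theta>"
    and x0: "x0 \<in> carrier G" "good x0" "x0 \<notin> centre"
  shows "p < 2 * card (set_mset M)"
proof -
  \<comment> \<open>Candidates for \<open>N\<close>. One of largest cardinality is chosen, so that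
    the strictly larger \<open>X\<close> must contain a good noncentral element.\<close>
  define P where "P = (\<lambda>N. N \<lhd> G \<and> centre \<subseteq> N \<and> (\<forall>x\<in>N. good x \<longrightarrow> x \<in> centre))"
  have "P centre" using centre_normal by (simp add: P_def)
  moreover have "\<forall>N. P N \<longrightarrow> card N < Suc (card (carrier G))"
    using finite_carrier
    by (auto simp: P_def normal_def less_Suc_eq_le intro!: card_mono dest: subgroup.subset)
  ultimately have "\<exists>N. P N \<and> (\<forall>N'. P N' \<longrightarrow> card N' \<le> card N)"
    by (rule ex_has_greatest_nat)
  then obtain N where N: "P N" and max: "\<And>N'. P N' \<Longrightarrow> card N' \<le> card N"
    by blast
  have NG: "N \<lhd> G" "centre \<subseteq> N" and gc: "\<And>x. x \<in> N \<Longrightarrow> good x \<Longrightarrow> x \<in> centre"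
    using N by (auto simp: P_def)
  have "N \<noteq> carrier G" using gc x0 by auto
  then obtain y where y: "y \<in> centre_mod N" "y \<notin> N" using centre_mod_grows[OF p ord NG(1)] by blast
  define X where "X = centre_mod N"
  have X: "X \<lhd> G" unfolding X_def by (rule centre_mod_normal[OF NG(1)])
  have fin: "finite X" using finite_subset[OF centre_mod_subset finite_carrier] by (simp add: X_def)
  have NX: "N \<subseteq> X" using subset_centre_mod[OF NG(1)] by (simp add: X_def)
  then have "card N < card X" using y fin by (intro psubset_card_mono) (auto simp: X_def)
  then have "\<not> P X" using max[of X] by auto
  then obtain x where x: "x \<in> X" "good x" "x \<notin> centre" using X NX NG(2) by (auto simp: P_def)
  have xN: "x \<notin> N" using gc x by auto
  define c where "c = real (card centre)"
  have cX: "centre \<subseteq> X" using NX NG(2) by auto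
  have "centre \<noteq> {}" using centre_normal by (auto simp: normal_def dest: subgroup.one_closed)
  then have c: "c > 0" using finite_subset[OF cX fin] by (simp add: c_def card_gt_0_iff)
  define W V where "W = (\<Sum>u\<in>X. weight u)" and "V = (\<Sum>u\<in>X. (weight u)\<^sup>2)"
  have W: "real p * c \<le> W"
    unfolding W_def c_def X_def
    by (rule sum_weight_lower_bound[OF p ord NG gc \<chi> _ x(2) xN]) (use x X_def in auto)
  have split: "sum f X = sum f centre + sum f (X - centre)" for f :: "'a \<Rightarrow> real"
    using sum.subset_diff[OF cX fin, of f] by (simp add: add.commute)
  \<comment> \<open>Off the centre the weights are at most \<open>1 / p\<close>, so squaring them
    shrinks the sum by at least the factor \<open>p\<close>.\<close>
  have "real p * (\<Sum>u\<in>X - centre. (weight u)\<^sup>2) \<le> (\<Sum>u\<in>X - centre. weight u)"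
    unfolding sum_distrib_left
  proof (rule sum_mono)
    fix u assume u: "u \<in> X - centre"
    then have "weight u \<le> 1 / real p"
      using weight_noncentral_le[OF p ord, of u] centre_mod_subset by (auto simp: X_def)
    then have "real p * weight u \<le> 1" using prime_gt_0_nat[OF p] by (simp add: field_simps)
    then have "(real p * weight u) * weight u \<le> 1 * weight u" using weight_nonneg by (intro mult_right_mono)
    then show "real p * (weight u)\<^sup>2 \<le> weight u" by (simp add: power2_eq_square mult.assoc)
  qed
  moreover have "W = c + (\<Sum>u\<in>X - centre. weight u)"
    unfolding W_def split by (simp add: weight_central c_def)
  moreover have "V = c + (\<Sum>u\<in>X - centre. (weight u)\<^sup>2)"
    unfolding V_def split by (simp add: weight_central c_def)
  \<comment> \<open>With \<open>p * c \<le> W\<close> the right side is at most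
    \<open>2 * W - c\<close>, and \<open>c > 0\<close> makes the next inequality strict.\<close>
  ultimately have "real p * V \<le> real p * c - c + W" by (simp add: distrib_left)
  then have pV: "real p * V < 2 * W" using W c by linarith
  \<comment> \<open>Each constituent has the ratio \<open>weight u\<close>, whereas the product of
    two such characters has its square.\<close>
  have "W \<le> real (card (set_mset M)) * V"
    unfolding W_def V_def
  proof (rule card_constituents_bound[OF X M])
    show "\<chi> \<one> * \<psi> \<one> \<noteq> 0" using \<chi> \<psi> by simp
  next
    fix \<theta> u assume "\<theta> \<in># M" and u: "u \<in> X"
    then show "\<theta> u * \<theta> (inv u) = of_real (weight u) * (\<theta> \<one>)\<^sup>2"
      using Irr_weight[OF NG(1) gc _ faithful] M by (auto simp: irr_decomposition_def X_def)
  next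
    fix u assume u: "u \<in> X"
    then have "\<chi> u * \<chi> (inv u) = of_real (weight u) * (\<chi> \<one>)\<^sup>2" "\<psi> u * \<psi> (inv u) = of_real (weight u) * (\<psi> \<one>)\<^sup>2"
      using Irr_weight[OF NG(1) gc \<chi>] Irr_weight[OF NG(1) gc \<psi>] by (auto simp: X_def)
    then have "(\<chi> u * \<chi> (inv u)) * (\<psi> u * \<psi> (inv u)) = of_real ((weight u)\<^sup>2) * (\<chi> \<one> * \<psi> \<one>)\<^sup>2"
      by (simp add: power2_eq_square mult_ac)
    then show "\<chi> u * \<psi> u * (\<chi> (inv u) * \<psi> (inv u)) = of_real ((weight u)\<^sup>2) * (\<chi> \<one> * \<psi> \<one>)\<^sup>2"
      by (simp only: mult_ac)
  qed (rule weight_nonneg)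
  then have "real p * V < (2 * real (card (set_mset M))) * V" using pV by simp
  moreover have "V \<ge> 0" unfolding V_def by (simp add: sum_nonneg)
  ultimately have "real p < 2 * real (card (set_mset M))" by (metis mult_less_cancel_right not_less)
  then show ?thesis by linarith
qed

lemma many_constituents_unfaithful:
  assumes p: "prime p" and ord: "Coset.order G = p ^ k"
    and \<chi>: "\<chi> \<in> Irr G" "faithful_on_centre \<chi>" and \<psi>: "\<psi> \<in> Irr G"
    and M: "irr_decomposition G (\<lambda>g. \<chi> g * \<psi> g) M"
    and z0: "z0 \<in> centre" "z0 \<noteq> \<one>" "\<chi> z0 * \<psi> z0 = \<chi> \<one> * \<psi> \<one>"
    and nonabelian: "centre \<noteq> carrier G"
  shows "p \<le> card (set_mset M)"
proof -
  interpret Z: normal centre G by (rule centre_normal)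
  have Zc: "centre \<subseteq> carrier G" by (rule centre_mod_subset)
  \<comment> \<open>The kernel of the central character of the product, which all constituents
    share.\<close>
  define K where "K = {z \<in> centre. \<chi> z * \<psi> z = \<chi> \<one> * \<psi> \<one>}"
  have d: "\<chi> \<one> * \<psi> \<one> \<noteq> 0" using \<chi> \<psi> by simp
  have mult: "(\<chi> \<one> * \<psi> \<one>) * (\<chi> (z \<otimes> y) * \<psi> (z \<otimes> y)) = (\<chi> z * \<psi> z) * (\<chi> y * \<psi> y)"
    if z: "z \<in> centre" and y: "y \<in> carrier G" for z y
  proof -
    have "(\<chi> \<one> * \<psi> \<one>) * (\<chi> (z \<otimes> y) * \<psi> (z \<otimes> y)) = (\<chi> \<one> * \<chi> (z \<otimes> y)) * (\<psi> \<one> * \<psi> (z \<otimes> y))"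
      by (simp only: mult_ac)
    also have "\<dots> = (\<chi> z * \<psi> z) * (\<chi> y * \<psi> y)"
      unfolding Irr_central_mult[OF \<chi>(1) z y] Irr_central_mult[OF \<psi> z y] by (simp only: mult_ac)
    finally show ?thesis .
  qed
  have central_inv: "(\<chi> z * \<psi> z) * (\<chi> (inv z) * \<psi> (inv z)) = (\<chi> \<one> * \<psi> \<one>)\<^sup>2" if z: "z \<in> centre" for z
  proof -
    have "(\<chi> z * \<psi> z) * (\<chi> (inv z) * \<psi> (inv z)) = (\<chi> z * \<chi> (inv z)) * (\<psi> z * \<psi> (inv z))"
      by (simp only: mult_ac)
    then show ?thesis
      using Irr_central_inv[OF \<chi>(1) z] Irr_central_inv[OF \<psi> z] by (simp add: power_mult_distrib)
  qed
  have K: "K \<lhd> G"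
  proof (rule normal_invI)
    show "subgroup K G"
    proof (rule subgroupI)
      show "K \<subseteq> carrier G" using Zc by (auto simp: K_def)
      show "K \<noteq> {}" using Z.one_closed by (auto simp: K_def intro!: exI[of _ \<one>])
    next
      fix z assume z: "z \<in> K"
      then show "inv z \<in> K" using central_inv[of z] d by (auto simp: K_def power2_eq_square)
    next
      fix z y assume z: "z \<in> K" and y: "y \<in> K"
      then have "(\<chi> \<one> * \<psi> \<one>) * (\<chi> (z \<otimes> y) * \<psi> (z \<otimes> y)) = (\<chi> \<one> * \<psi> \<one>) * (\<chi> \<one> * \<psi> \<one>)"
        using mult[of z y] Zc by (auto simp: K_def)
      then have "\<chi> (z \<otimes> y) * \<psi> (z \<otimes> y) = \<chi> \<one> * \<psi> \<one>" using d by (metis mult_left_cancel)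
      then show "z \<otimes> y \<in> K" using z y by (simp add: K_def)
    qed
  next
    fix g z assume g: "g \<in> carrier G" and z: "z \<in> K"
    from this have "g \<otimes> z \<otimes> inv g = z" unfolding K_def mem_centre by blast
    then show "g \<otimes> z \<otimes> inv g \<in> K" using z by simp
  qed
  have K1: "\<one> \<in> K" unfolding K_def using Z.one_closed by blast
  define X where "X = centre_mod K"
  have X_iff: "x \<in> X \<longleftrightarrow> x \<in> carrier G \<and> (\<forall>g\<in>carrier G. g \<otimes> x \<otimes> inv g \<otimes> inv x \<in> K)" for x
    unfolding X_def centre_mod_def by blast
  have X: "X \<lhd> G" unfolding X_def by (rule centre_mod_normal[OF K])
  interpret X: normal X G by (rule X)
  have fin: "finite X" using finite_subset[OF X.subset finite_carrier] .
  have ZX: "centre \<subseteq> X" unfolding X_def by (rule centre_subset_centre_mod[OF K1])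
  text \<open>The second centre contains an element outside the centre whose commutators have order
    dividing \<open>p\<close>; as the centre is cyclic, these commutators are powers of any element of order
    \<open>p\<close> in \<open>K\<close>.\<close>
  have "X \<noteq> centre"
  proof -
    \<comment> \<open>The central character of \<open>\<chi>\<close>. Its injectivity stands in for
      cyclicity of the centre.\<close>
    define l where "l = (\<lambda>z. \<chi> z / \<chi> \<one>)"
    have l_mult: "l (z \<otimes> y) = l z * l y" if "z \<in> centre" "y \<in> centre" for z y
    proof -
      have "\<chi> \<one> * \<chi> (z \<otimes> y) = \<chi> z * \<chi> y" using Irr_central_mult[OF \<chi>(1) that(1)] that(2) Zc by auto
      then show ?thesis using Irr_degree_nonzero[OF \<chi>(1)] by (simp add: l_def field_simps)
    qed
    have l_one: "l \<one> = 1" using \<chi> by (simp add: l_def)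
    have l_pow: "l (z [^] (n :: nat)) = l z ^ n" if z: "z \<in> centre" for z n
    proof (induction n)
      case (Suc n)
      then show ?case
        using l_mult[OF subgroup_nat_pow_closed[OF Z.subgroup_axioms z, of n] z] by (simp add: mult.commute)
    qed (simp add: l_one)
    have l_inj: "z = y" if zy: "z \<in> centre" "y \<in> centre" "l z = l y" for z y
    proof -
      have "l (z \<otimes> inv y) = l (y \<otimes> inv y)" using zy l_mult[of z "inv y"] l_mult[of y "inv y"] by simp
      then have "l (z \<otimes> inv y) = 1" using zy(2) Zc l_one by auto
      then have "\<chi> (z \<otimes> inv y) = \<chi> \<one>" using \<chi>(1) by (simp add: l_def)
      then have "z \<otimes> inv y = \<one>" using \<chi>(2) zy by (simp add: faithful_on_centre_def)
      then show ?thesis using zy(1,2) Zc by (simp add: mult_inv_eq_one_iff subset_iff)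
    qed
    \<comment> \<open>An element of order \<open>p\<close> in \<open>K\<close>, found among the
      iterated \<open>p\<close>-th powers of \<open>z0\<close>.\<close>
    obtain z1 where z1: "z1 \<in> K" "z1 \<noteq> \<one>" "z1 [^] p = \<one>"
    proof -
      have z0c: "z0 \<in> carrier G" using z0 Zc by auto
      obtain m where m: "z0 [^] (p ^ m) \<notin> {\<one>}" "(z0 [^] (p ^ m)) [^] p \<in> {\<one>}"
        by (rule last_p_power_outside[OF p ord triv_subgroup z0c]) (use z0 in auto)
      have "z0 \<in> K" using z0 by (simp add: K_def)
      then have "z0 [^] (p ^ m) \<in> K" using subgroup_nat_pow_closed K by (simp add: normal_def)
      then show ?thesis using that m by blast
    qed
    have z1Z: "z1 \<in> centre" using z1 by (simp add: K_def)
    have l1: "l z1 ^ p = 1" using l_pow[OF z1Z, of p] z1 l_one by simp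
    have l1': "l z1 \<noteq> 1" using l_inj[OF z1Z Z.one_closed] z1 l_one by auto
    \<comment> \<open>\<open>l\<close> maps such a \<open>c\<close> to a \<open>p\<close>-th root of
      unity, hence to a power of \<open>l z1\<close>; by injectivity \<open>c\<close> is a power of
      \<open>z1\<close>.\<close>
    have torsion: "c \<in> K" if c: "c \<in> centre" "c [^] p = \<one>" for c
    proof -
      have "l c ^ p = 1" using l_pow[OF c(1), of p] c l_one by simp
      then obtain j where "l c = l z1 ^ j" using prime_root_of_unity_power[OF p l1 l1'] by blast
      then have "l c = l (z1 [^] j)" using l_pow[OF z1Z] by simp
      then have "c = z1 [^] j" using l_inj[OF c(1)] subgroup_nat_pow_closed[OF Z.subgroup_axioms z1Z] by blast
      then show ?thesis using subgroup_nat_pow_closed z1(1) K by (simp add: normal_def)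
    qed
    obtain y0 where y0: "y0 \<in> centre_mod centre" "y0 \<notin> centre"
      using centre_mod_grows[OF p ord centre_normal nonabelian] by blast
    have y0c: "y0 \<in> carrier G" using y0 centre_mod_subset by auto
    obtain m where m: "y0 [^] (p ^ m) \<notin> centre" "(y0 [^] (p ^ m)) [^] p \<in> centre"
      by (rule last_p_power_outside[OF p ord Z.subgroup_axioms y0c y0(2)])
    define y where "y = y0 [^] (p ^ m)"
    have y: "y \<in> centre_mod centre" "y \<in> carrier G" "y \<notin> centre" "y [^] p \<in> centre"
      using subgroup_nat_pow_closed[of "centre_mod centre" y0] centre_mod_normal[OF centre_normal] y0 y0c m
      by (auto simp: y_def normal_def)
    have "g \<otimes> y \<otimes> inv g \<otimes> inv y \<in> K" if g: "g \<in> carrier G" for g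
    proof -
      define c where "c = g \<otimes> y \<otimes> inv g \<otimes> inv y"
      have c: "c \<in> centre" using y(1) g unfolding c_def centre_mod_def[of centre] by blast
      have cc: "c \<in> carrier G" using c Zc by auto
      have cy: "g \<otimes> y \<otimes> inv g = c \<otimes> y" unfolding c_def by (rule commutator_mult_eq[OF g y(2), symmetric])
      \<comment> \<open>Conjugation fixes the central element \<open>y [^] p\<close> but also
        multiplies it by \<open>c [^] p\<close>, which is therefore trivial.\<close>
      have "y [^] p = g \<otimes> y [^] p \<otimes> inv g" using y(4) g unfolding mem_centre by metis
      also have "\<dots> = (c \<otimes> y) [^] p" using conjugate_pow[OF g y(2)] cy by simp
      also have "\<dots> = c [^] p \<otimes> y [^] p"
        using pow_mult_distrib[of c y p] mem_centre_commute[OF c y(2)] cc y(2) by simp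
      finally have "c [^] p = \<one>" using cc y(2) by (metis nat_pow_closed r_cancel_one)
      then show ?thesis using torsion[OF c] by (simp add: c_def)
    qed
    then have "y \<in> X" using y(2) X_iff by blast
    then show ?thesis using y(3) by auto
  qed
  then have "centre \<subset> X" using ZX by auto
  then have lt: "card centre < card X" using fin by (rule psubset_card_mono[rotated])
  have dvd: "card H dvd p ^ k" if "subgroup H G" for H
    using lagrange[OF that] ord by (metis dvd_triv_right)
  obtain a b where ab: "card centre = p ^ a" "card X = p ^ b"
    using dvd[OF Z.subgroup_axioms] dvd[OF X.subgroup_axioms] divides_primepow_nat[OF p] by metis
  \<comment> \<open>Both orders are powers of \<open>p\<close>, so the strict inclusion has index at
    least \<open>p\<close>.\<close>
  have "a < b" using lt ab prime_gt_1_nat[OF p] by (simp add: power_strict_increasing_iff)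
  then have "p ^ Suc a \<le> p ^ b" using prime_gt_0_nat[OF p] by (intro power_increasing) auto
  then have big: "p * card centre \<le> card X" using ab by simp
  \<comment> \<open>Commutators of elements of \<open>X\<close> lie in \<open>K\<close>, where every
    constituent takes its degree as value; this gives ratio 1. On \<open>X\<close> outside the
    centre \<open>\<chi>\<close> vanishes, since it is faithful on these central
    commutators.\<close>
  have "(\<Sum>x\<in>X. 1 :: real) \<le> real (card (set_mset M)) * (\<Sum>x\<in>X. if x \<in> centre then 1 else 0)"
  proof (rule card_constituents_bound[OF X M d])
    fix \<theta> x assume \<theta>: "\<theta> \<in># M" and x: "x \<in> X"
    have \<theta>I: "\<theta> \<in> Irr G" using M \<theta> by (auto simp: irr_decomposition_def)
    have xc: "x \<in> carrier G" using x X.subset by auto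
    have "\<theta> (u \<otimes> inv x) = \<theta> \<one>" if "u \<in> conj_class x" for u
    proof -
      have uK: "u \<otimes> inv x \<in> K" using that x X_iff unfolding conj_class_def by blast
      then have "\<theta> (u \<otimes> inv x) * (\<chi> \<one> * \<psi> \<one>) = (\<chi> \<one> * \<psi> \<one>) * \<theta> \<one>"
        using constituent_on_centre[OF \<chi>(1) \<psi> M \<theta>, of "u \<otimes> inv x"] by (simp add: K_def)
      then show ?thesis using d by (simp add: mult.commute)
    qed
    then have "of_nat (card (conj_class x)) * (\<theta> x * \<theta> (inv x)) = of_nat (card (conj_class x)) * (\<theta> \<one>)\<^sup>2"
      unfolding conj_class_sum[OF \<theta>I xc, symmetric] by (simp add: power2_eq_square)
    moreover have "complex_of_nat (card (conj_class x)) \<noteq> 0"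
      using card_conj_class_pos[OF xc] by (simp only: of_nat_eq_0_iff)
    ultimately show "\<theta> x * \<theta> (inv x) = of_real 1 * (\<theta> \<one>)\<^sup>2"
      by (metis mult_left_cancel mult_1 of_real_1)
  next
    fix x assume x: "x \<in> X"
    show "\<chi> x * \<psi> x * (\<chi> (inv x) * \<psi> (inv x)) = of_real (if x \<in> centre then 1 else 0) * (\<chi> \<one> * \<psi> \<one>)\<^sup>2"
    proof (cases "x \<in> centre")
      case True
      then show ?thesis using central_inv by simp
    next
      case False
      have xc: "x \<in> carrier G" using x X.subset by auto
      obtain g where g: "g \<in> carrier G" "g \<otimes> x \<otimes> inv g \<noteq> x" using False xc unfolding mem_centre by blast
      have "g \<otimes> x \<otimes> inv g \<otimes> inv x \<in> K" using x g(1) X_iff by blast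
      then have c: "g \<otimes> x \<otimes> inv g \<otimes> inv x \<in> centre" by (simp add: K_def)
      moreover have "g \<otimes> x \<otimes> inv g \<otimes> inv x \<noteq> \<one>" using g xc by (simp add: mult_inv_eq_one_iff)
      ultimately have "\<chi> (g \<otimes> x \<otimes> inv g \<otimes> inv x) \<noteq> \<chi> \<one>" using \<chi>(2) by (auto simp: faithful_on_centre_def)
      then have "\<chi> x = 0" using Irr_vanish[OF \<chi>(1) xc g(1) c] by simp
      then show ?thesis using False by simp
    qed
  qed simp
  moreover have "(\<Sum>x\<in>X. if x \<in> centre then 1 else 0 :: real) = real (card centre)"
    using ZX fin by (simp add: sum.If_cases Int_absorb1)
  ultimately have "card X \<le> card (set_mset M) * card centre"
    by (simp flip: of_nat_mult)
  then have "p * card centre \<le> card (set_mset M) * card centre" using big by linarith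
  moreover have "card centre > 0" using ab prime_gt_0_nat[OF p] by simp
  ultimately show ?thesis by simp
qed

lemma eta_one_or_large:
  assumes p: "prime p" and ord: "Coset.order G = p ^ k"
    and \<chi>: "\<chi> \<in> Irr G" and \<psi>: "\<psi> \<in> Irr G"
    and f: "faithful_on_centre \<chi>" "faithful_on_centre \<psi>"
  shows "eta G \<chi> \<psi> = 1 \<or> p < 2 * eta G \<chi> \<psi>"
proof -
  obtain M where M: "irr_decomposition G (\<lambda>g. \<chi> g * \<psi> g) M"
    using Irr_mult_decomposition[OF is_group \<chi> \<psi>] .
  have MI: "\<theta> \<in> Irr G" if "\<theta> \<in># M" for \<theta> using M that by (auto simp: irr_decomposition_def)
  have "card (set_mset M) = 1 \<or> p < 2 * card (set_mset M)"
  proof (cases "centre = carrier G")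
    case True
    \<comment> \<open>In an abelian group nothing lies off the centre, so the vanishing condition is
      vacuous.\<close>
    then show ?thesis using single_constituent[OF \<chi> \<psi> M] by auto
  next
    case nonabelian: False
    show ?thesis
    proof (cases "\<exists>z\<in>centre. z \<noteq> \<one> \<and> \<chi> z * \<psi> z = \<chi> \<one> * \<psi> \<one>")
      case True
      then have "p \<le> card (set_mset M)"
        using many_constituents_unfaithful[OF p ord \<chi> f(1) \<psi> M _ _ _ nonabelian] by blast
      then show ?thesis using prime_gt_0_nat[OF p] by linarith
    next
      case False
      \<comment> \<open>A central \<open>z\<close> in the kernel of a constituent lies in the kernel
        of the shared central character, which is trivial in this case.\<close>
      have fM: "faithful_on_centre \<theta>" if \<theta>: "\<theta> \<in># M" for \<theta>
        unfolding faithful_on_centre_def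
      proof (intro ballI impI)
        fix z assume z: "z \<in> centre" and eq: "\<theta> z = \<theta> \<one>"
        have "\<theta> \<one> * (\<chi> \<one> * \<psi> \<one>) = \<theta> \<one> * (\<chi> z * \<psi> z)"
          using constituent_on_centre[OF \<chi> \<psi> M \<theta> z] eq by (simp add: mult.commute)
        then have "\<chi> z * \<psi> z = \<chi> \<one> * \<psi> \<one>" using Irr_degree_nonzero[OF MI[OF \<theta>]] by (metis mult_left_cancel)
        then show "z = \<one>" using False z by blast
      qed
      show ?thesis
      proof (cases "\<exists>x\<in>carrier G. good x \<and> x \<notin> centre")
        case True
        then show ?thesis using many_constituents_faithful[OF p ord \<chi> f(1) \<psi> f(2) M fM] by blast
      next
        case False
        then have "\<theta> x = 0" if "\<theta> \<in># M" "x \<in> carrier G" "x \<notin> centre" for \<theta> x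
          using not_good_vanish[OF MI[OF that(1)] fM[OF that(1)] that(2)] that by blast
        then show ?thesis using single_constituent[OF \<chi> \<psi> M] by blast
      qed
    qed
  qed
  then show ?thesis by (simp only: eta_eq_card[OF M])
qed

end

theorem theoremA:
  fixes G :: "('a, 'b) monoid_scheme" and p k :: nat
    and \<chi> \<psi> :: "'a \<Rightarrow> complex"
  assumes "group G" and "prime p" and "Coset.order G = p ^ k"
    and "\<chi> \<in> Irr G" and "\<psi> \<in> Irr G"
    and "faithful_char G \<chi>" and "faithful_char G \<psi>"
  shows "eta G \<chi> \<psi> = 1 \<or> 2 * eta G \<chi> \<psi> > p"
proof -
  interpret group G by fact
  \<comment> \<open>Infinite sets have cardinality 0, so a positive order yields finiteness.\<close>
  have "card (carrier G) > 0" using assms(2,3) prime_gt_0_nat by (simp add: Coset.order_def)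
  then interpret fin_group G by unfold_locales (simp add: card_gt_0_iff)
  show ?thesis using assms by (intro eta_one_or_large) (auto intro: faithful_char_on_centre)
qed

end
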